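(* Let $p$ be an odd prime, let $n,l,t$ be positive integers, let $k=lt$, and let $f\in\mathcal{GB}_n^{p^k}$ be defined as $f(\mathbf{x})=\sum_{i=1}^{l}p^{(i-1)t}b_i(\mathbf{x})$, where $b_i\in\mathcal{GB}_n^{p^t}$, $1\le i\le l$. Then $f$ is gbent if and only if for any $\mathbf{u}\in\mathbb{Z}_p^n$ and $\mathbf{c}=(c_1,\dots,c_{l-1})\in\mathbb{Z}_{p^t}^{l-1}$ there exist some $\mathbf{d}\in\mathbb{Z}_{p^t}^{l-1}$ and $j\in\mathbb{Z}_{p^t}$ such that $$\mathcal{H}_{b_l+\sum_{i=1}^{l-1}c_ib_i}(\mathbf{u})=\begin{cases}\pm\,\zeta_{p^t}^{j+\mathbf{c}\cdot\mathbf{d}} & \text{if } n \text{ is even, or } n \text{ is odd and } p\equiv 1 \pmod 4,\\ \pm\sqrt{-1}\,\zeta_{p^t}^{j+\mathbf{c}\cdot\mathbf{d}} & \text{if } n \text{ is odd and } p\equiv 3 \pmod 4,\end{cases}$$ where $b_l+\sum_{i=1}^{l-1}c_ib_i\in\mathcal{GB}_n^{p^t}$ for every $\mathbf{c}\in\mathbb{Z}_{p^t}^{l-1}$, and $\mathbf{d}$ and $j$ only depend on $\mathbf{u}$ and $f$.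
   Context: $\mathbb{Z}_m$ is the ring of integers modulo $m$, and $\zeta_m=e^{2\pi\sqrt{-1}/m}$. $\mathcal{GB}_n^{p^r}$ is the set of all functions $\mathbb{Z}_p^n\to\mathbb{Z}_{p^r}$. For $F\in\mathcal{GB}_n^{p^r}$ the generalized Walsh-Hadamard transform is $\mathcal{H}_F(\mathbf{u})=p^{-n/2}\sum_{\mathbf{x}\in\mathbb{Z}_p^n}\zeta_p^{-\mathbf{u}\cdot\mathbf{x}}\zeta_{p^r}^{F(\mathbf{x})}$ for $\mathbf{u}\in\mathbb{Z}_p^n$; $F$ is called gbent if $|\mathcal{H}_F(\mathbf{u})|=1$ for all $\mathbf{u}\in\mathbb{Z}_p^n$. Inner products are $\mathbf{x}\cdot\mathbf{y}=\sum_i x_iy_i$ in the relevant ring. In the expansion $\sum p^{(i-1)t}b_i(\mathbf{x})$, elements of $\mathbb{Z}_{p^t}$ are identified with their representatives in $\{0,\dots,p^t-1\}$.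
   Formalization: The sign ± is required to depend only on u and f, like d and j, and not on c; if the sign may vary with c, the "if" direction fails (there is a counterexample with p=3, t=1, l=2, n=6). *)

theory Defs
  imports "HOL-Analysis.Analysis" "HOL-Number_Theory.Number_Theory"
begin

text \<open>
  The ring of integers modulo m is the library's \<^term>\<open>residue_ring m\<close>, so its elements are the
  representatives 0, ..., m - 1 and its operations are integer operations followed by reduction
  modulo m. Vectors of length n have coordinates indexed by 1, ..., n; vectors and functions on
  them are extensional (fixed to \<^term>\<open>undefined\<close> outside their domain).
\<close>

definition Zmod :: "nat \<Rightarrow> int set" where
  "Zmod m = carrier (residue_ring (int m))"

definition Zvec :: "nat \<Rightarrow> nat \<Rightarrow> (nat \<Rightarrow> int) set" where
  "Zvec m n = {1..n} \<rightarrow>\<^sub>E Zmod m"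

definition dotp :: "nat \<Rightarrow> nat \<Rightarrow> (nat \<Rightarrow> int) \<Rightarrow> (nat \<Rightarrow> int) \<Rightarrow> int" where
  "dotp m n x y = (\<Sum>i = 1..n. x i * y i) mod int m"

definition zeta :: "nat \<Rightarrow> complex" where
  "zeta m = exp (2 * of_real pi * \<i> / of_nat m)"

definition GB :: "nat \<Rightarrow> nat \<Rightarrow> nat \<Rightarrow> ((nat \<Rightarrow> int) \<Rightarrow> int) set" where
  "GB p n r = Zvec p n \<rightarrow>\<^sub>E Zmod (p ^ r)"

definition WHT :: "nat \<Rightarrow> nat \<Rightarrow> nat \<Rightarrow> ((nat \<Rightarrow> int) \<Rightarrow> int) \<Rightarrow> (nat \<Rightarrow> int) \<Rightarrow> complex" where
  "WHT p n r F u =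
     of_real (real p powr (- (real n / 2))) *
     (\<Sum>x\<in>Zvec p n. zeta p powi (- dotp p n u x) * zeta (p ^ r) powi F x)"

definition gbent :: "nat \<Rightarrow> nat \<Rightarrow> nat \<Rightarrow> ((nat \<Rightarrow> int) \<Rightarrow> int) \<Rightarrow> bool" where
  "gbent p n r F \<longleftrightarrow> F \<in> GB p n r \<and> (\<forall>u\<in>Zvec p n. cmod (WHT p n r F u) = 1)"

text \<open>
  The sum of \<open>p ^ ((i - 1) * t) * b i\<close> for i from 1 to l. When each \<open>b i\<close> takes values in
  0, ..., p^t - 1, this integer sum lies between 0 and p^(l*t) - 1, so no reduction is needed.
\<close>

definition base_expansion ::
    "nat \<Rightarrow> nat \<Rightarrow> nat \<Rightarrow> nat \<Rightarrow> (nat \<Rightarrow> (nat \<Rightarrow> int) \<Rightarrow> int) \<Rightarrow> (nat \<Rightarrow> int) \<Rightarrow> int" where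
  "base_expansion p n l t b =
     (\<lambda>x\<in>Zvec p n. \<Sum>i = 1..l. int p ^ ((i - 1) * t) * b i x)"

definition component_comb ::
    "nat \<Rightarrow> nat \<Rightarrow> nat \<Rightarrow> nat \<Rightarrow> (nat \<Rightarrow> (nat \<Rightarrow> int) \<Rightarrow> int) \<Rightarrow> (nat \<Rightarrow> int) \<Rightarrow> (nat \<Rightarrow> int) \<Rightarrow> int" where
  "component_comb p n l t b c =
     (\<lambda>x\<in>Zvec p n. (b l x + (\<Sum>i = 1..l - 1. c i * b i x)) mod int (p ^ t))"

lemma Zmod_eq: "Zmod m = {0..<int m}"
  by (auto simp: Zmod_def residue_ring_def)

lemma base_expansion_in_GB:
  assumes p: "p \<ge> 1" and b: "\<And>i. 1 \<le> i \<Longrightarrow> i \<le> l \<Longrightarrow> b i \<in> GB p n t"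
  shows "base_expansion p n l t b \<in> GB p n (l * t)"
proof -
  have "0 \<le> (\<Sum>i = 1..l. int p ^ ((i - 1) * t) * b i x) \<and>
        (\<Sum>i = 1..l. int p ^ ((i - 1) * t) * b i x) < int p ^ (l * t)"
    if x: "x \<in> Zvec p n" for x
    using b
  proof (induction l)
    case 0
    then show ?case by simp
  next
    case (Suc l)
    let ?S = "\<Sum>i = 1..l. int p ^ ((i - 1) * t) * b i x"
    have IH: "0 \<le> ?S" "?S < int p ^ (l * t)"
      using Suc by auto
    have "b (Suc l) x \<in> Zmod (p ^ t)"
      using Suc.prems[of "Suc l"] x by (auto simp: GB_def)
    hence r: "0 \<le> b (Suc l) x" "b (Suc l) x \<le> int p ^ t - 1"
      by (auto simp: Zmod_eq)
    have "int p ^ (l * t) * b (Suc l) x \<le> int p ^ (l * t) * (int p ^ t - 1)"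
      using r by (intro mult_left_mono) auto
    also have "\<dots> = int p ^ (Suc l * t) - int p ^ (l * t)"
      by (simp add: algebra_simps power_add)
    finally show ?case
      using IH r by simp
  qed
  thus ?thesis
    by (auto simp: base_expansion_def GB_def Zmod_eq)
qed

lemma component_comb_in_GB:
  assumes "p \<ge> 1"
  shows "component_comb p n l t b c \<in> GB p n t"
  using assms by (auto simp: component_comb_def GB_def Zmod_eq)

end

theory Submission
  imports Defs "HOL-Computational_Algebra.Polynomial_Factorial"
begin

text \<open>
  Write q = p^k, M = p^t, and group the points x by the vector v of the lower digits
  b_1(x), ..., b_(l-1)(x). With A_v the part of the character sum that comes from the fibre over v,
  the transform of f at u is p^(-n/2) times the sum of A_v * zeta_q^e(v), where e(v) is the number
  with base M digits v, and the transform of b_l + c.b at u is p^(-n/2) times the sum of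
  A_v * zeta_M^(c.v). Both are therefore transforms of one and the same family A, whose members lie
  in \<int>[zeta_M]. The theorem holds because, for each u, both of its sides are equivalent to A being
  concentrated in a single fibre d, with value s * p^(n/2) * zeta_M^j there, or that times \<i>
  if n is odd and p is 3 modulo 4.

  For the component functions this is Fourier inversion on (\<int>/M)^(l-1)
  (\<open>Zvec_fourier_delta_iff\<close>). For f, concentration clearly implies absolute value 1; the
  converse is the arithmetic part. It rests on two facts about \<int>[zeta_q].

  \<^item> An element \<alpha> of \<int>[zeta_q] with |\<alpha>|^2 = p^n is s * zeta_q^m * G^n, with a sign s
    and a fixed square root G of \<plusminus>p in \<int>[zeta_p] (\<open>norm_p_power_in_adjoin_zeta\<close>).
    The element 1 - zeta_q generates a prime ideal that is stable under complex conjugation and p is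
    a unit times a power of it, so p^n divides \<alpha> * G^n, whose absolute value is p^n.
    The quotient has absolute value 1, and
    comparing the sum of |.|^2 over its conjugates with the coordinates shows that it has just one
    nonzero coordinate, equal to 1 or -1 (\<open>unimodular_in_adjoin_zeta\<close>). The power G^n is,
    up to sign, p^(n/2) or \<i> * p^(n/2), whence the two cases.

  \<^item> The powers zeta_q^e with e < M^(l-1) are linearly independent over \<int>[zeta_M]
    (\<open>zeta_powers_independent\<close>). Writing m = M^(l-1) * j + e(d) modulo q, comparison of coefficients
    leaves A_d as the only nonzero A_v.

  Both facts use the conjugations zeta_q \<mapsto> zeta_q^a for a prime to p. They are available because
  the cyclotomic polynomial of order q, which Eisenstein's criterion proves irreducible, divides every
  integer polynomial that vanishes at zeta_q (\<open>cyclo_dvd_if_ipoly_0\<close>).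
\<close>

hide_const (open) up_ring.monom up_ring.coeff module.smult

section \<open>Values of integer polynomials at complex numbers\<close>

definition ipoly :: "int poly \<Rightarrow> complex \<Rightarrow> complex" where
  "ipoly P z = poly (map_poly of_int P) z"

lemma ipoly_0 [simp]: "ipoly 0 z = 0"
  and ipoly_pCons [simp]: "ipoly (pCons a P) z = of_int a + z * ipoly P z"
  by (simp_all add: ipoly_def map_poly_pCons)

lemma ipoly_1 [simp]: "ipoly 1 z = 1"
  by (simp add: one_pCons)

lemma ipoly_add [simp]: "ipoly (P + Q) z = ipoly P z + ipoly Q z"
  by (induction P Q rule: poly_induct2) (auto simp: algebra_simps)

lemma ipoly_uminus [simp]: "ipoly (- P) z = - ipoly P z"
  by (induction P) (auto simp: algebra_simps)

lemma ipoly_diff [simp]: "ipoly (P - Q) z = ipoly P z - ipoly Q z"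
  using ipoly_add[of P "- Q" z] by simp

lemma ipoly_smult [simp]: "ipoly (smult a P) z = of_int a * ipoly P z"
  by (induction P) (auto simp: algebra_simps)

lemma ipoly_mult [simp]: "ipoly (P * Q) z = ipoly P z * ipoly Q z"
  by (induction P) (auto simp: algebra_simps)

lemma ipoly_power [simp]: "ipoly (P ^ m) z = ipoly P z ^ m"
  by (induction m) auto

lemma ipoly_sum [simp]: "ipoly (sum F A) z = (\<Sum>a\<in>A. ipoly (F a) z)"
  by (induction A rule: infinite_finite_induct) auto

lemma ipoly_monom [simp]: "ipoly (monom a m) z = of_int a * z ^ m"
  by (simp add: ipoly_def map_poly_monom poly_monom)

lemma ipoly_pcompose [simp]: "ipoly (pcompose P Q) z = ipoly P (ipoly Q z)"
  by (induction P) (auto simp: pcompose_pCons)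

lemma ipoly_altdef: "ipoly P z = (\<Sum>i\<le>degree P. of_int (coeff P i) * z ^ i)"
proof -
  have "ipoly P z = ipoly (\<Sum>i\<le>degree P. monom (coeff P i) i) z"
    by (simp only: poly_as_sum_of_monoms)
  thus ?thesis by simp
qed

section \<open>The cyclotomic polynomial of prime power order\<close>

lemma freshmans_dream_dvd:
  fixes x y :: "'a :: comm_ring_1"
  assumes p: "prime p"
  shows "of_nat p dvd (x + y) ^ p - x ^ p - y ^ p"
proof -
  have p0: "p > 0" using p prime_gt_0_nat by blast
  have "(x + y) ^ p = (\<Sum>i\<in>{..p}. of_nat (p choose i) * x ^ i * y ^ (p - i))"
    by (rule binomial_ring)
  also have "\<dots> = (\<Sum>i\<in>{0,p}. of_nat (p choose i) * x ^ i * y ^ (p - i)) +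
      (\<Sum>i\<in>{..p} - {0,p}. of_nat (p choose i) * x ^ i * y ^ (p - i))"
    by (subst sum.union_disjoint [symmetric]) (auto intro: sum.cong)
  also have "(\<Sum>i\<in>{0,p}. of_nat (p choose i) * x ^ i * y ^ (p - i)) = y ^ p + x ^ p"
    using p0 by simp
  finally have "(x + y) ^ p - x ^ p - y ^ p =
      (\<Sum>i\<in>{..p} - {0,p}. of_nat (p choose i) * x ^ i * y ^ (p - i))"
    by (simp add: algebra_simps)
  also have "of_nat p dvd \<dots>"
  proof (intro dvd_sum dvd_mult2)
    fix i assume "i \<in> {..p} - {0, p}"
    hence "p dvd (p choose i)" using p p0 by (intro dvd_choose_prime) auto
    thus "(of_nat p :: 'a) dvd of_nat (p choose i)" by (metis dvdE dvd_triv_left of_nat_mult)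
  qed
  finally show ?thesis .
qed

text \<open>
  Iterating the freshman's dream: after the shift X \<mapsto> X + 1 the polynomial X^(p^j) - 1 is a pure
  power of X modulo p, which is what Eisenstein's criterion will be fed with.
\<close>

lemma power_X_plus_1_cong:
  assumes p: "prime p"
  shows "(of_nat p :: int poly) dvd [:1, 1:] ^ (p ^ j) - monom 1 (p ^ j) - 1"
proof (induction j)
  case 0
  have "[:1, 1:] - monom 1 1 - 1 = (0 :: int poly)"
    by (simp add: monom_Suc one_pCons monom_0)
  thus ?case by simp
next
  case (Suc j)
  let ?N = "p ^ j"
  let ?Y = "monom 1 ?N :: int poly"
  have "[:1,1:] ^ ?N - (?Y + 1) dvd ([:1,1:] ^ ?N) ^ p - (?Y + 1) ^ p"
    by (subst power_diff_sumr2) simp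
  moreover have "of_nat p dvd [:1,1:] ^ ?N - (?Y + 1)"
    using Suc by (simp only: diff_diff_eq)
  ultimately have 1: "of_nat p dvd ([:1,1:] ^ ?N) ^ p - (?Y + 1) ^ p"
    by (rule dvd_trans[rotated])
  have 2: "of_nat p dvd (?Y + 1) ^ p - ?Y ^ p - 1 ^ p"
    by (rule freshmans_dream_dvd[OF p])
  have eqs: "([:1,1:] ^ ?N) ^ p = [:1,1:] ^ (p ^ Suc j)" "?Y ^ p = monom 1 (p ^ Suc j)"
    by (simp_all add: power_mult [symmetric] monom_power mult.commute)
  have "of_nat p dvd ([:1,1:] ^ ?N) ^ p - ?Y ^ p - 1"
    using dvd_add[OF 1 2] by (simp add: algebra_simps)
  thus ?case by (simp only: eqs)
qed

lemma eisenstein_monic: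
  fixes P :: "int poly"
  assumes p: "prime p" and monic: "lead_coeff P = 1" and deg: "degree P > 0"
    and low: "\<And>i. i < degree P \<Longrightarrow> p dvd coeff P i" and const: "\<not> p ^ 2 dvd coeff P 0"
  shows "irreducible P"
proof (rule irreducibleI)
  show "P \<noteq> 0" using deg by auto
  show "\<not> is_unit P" using deg by (auto simp: is_unit_poly_iff)
next
  \<comment> \<open>As p divides the constant coefficient of A, it does not divide that of B. If B were not
    constant, all coefficients of A would have an index below the degree of P, and p would divide
    each of them by induction, which is impossible for a factor of a monic polynomial.\<close>
  have key: "degree B = 0" if P: "P = A * B" and A0: "p dvd coeff A 0" for A B
  proof (rule ccontr)
    assume B: "degree B \<noteq> 0"
    have nz: "A \<noteq> 0" "B \<noteq> 0" using P deg by auto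
    have degAB: "degree P = degree A + degree B" using P nz degree_mult_eq by blast
    have B0: "\<not> p dvd coeff B 0"
    proof
      assume "p dvd coeff B 0"
      hence "p * p dvd coeff A 0 * coeff B 0" using A0 by (rule mult_dvd_mono[rotated])
      thus False using const P by (simp add: mult.commute coeff_mult_0 power2_eq_square)
    qed
    have "p dvd coeff A i" if "i \<le> degree A" for i
      using that
    proof (induction i rule: less_induct)
      case (less i)
      have "coeff P i = (\<Sum>j\<le>i. coeff A j * coeff B (i - j))"
        by (simp add: P coeff_mult)
      also have "\<dots> = coeff A i * coeff B 0 + (\<Sum>j<i. coeff A j * coeff B (i - j))"
        by (simp add: lessThan_Suc_atMost [symmetric])
      finally have "coeff A i * coeff B 0 = coeff P i - (\<Sum>j<i. coeff A j * coeff B (i - j))"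
        by simp
      moreover have "p dvd coeff P i" using less B degAB by (intro low) auto
      moreover have "p dvd (\<Sum>j<i. coeff A j * coeff B (i - j))"
        using less by (intro dvd_sum dvd_mult2) auto
      ultimately have "p dvd coeff A i * coeff B 0" by auto
      thus ?case using p B0 prime_dvd_mult_iff by blast
    qed
    hence "p dvd lead_coeff A" by simp
    hence "p dvd lead_coeff P" by (simp add: P lead_coeff_mult)
    thus False using monic p not_prime_unit by auto
  qed
  fix A B assume P: "P = A * B"
  have unit: "is_unit C" if "P = C * D" "degree C = 0" for C D
  proof -
    obtain c where c: "C = [:c:]" using \<open>degree C = 0\<close> degree_eq_zeroE by blast
    have "c * lead_coeff D = 1" using monic unfolding that(1) c lead_coeff_mult by simp
    hence "is_unit c" by (metis dvd_triv_left)
    thus ?thesis using c by (auto simp: is_unit_poly_iff)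
  qed
  have "p dvd coeff A 0 * coeff B 0"
    using low[of 0] deg by (simp add: P coeff_mult_0)
  hence "p dvd coeff A 0 \<or> p dvd coeff B 0" using p prime_dvd_mult_iff by blast
  thus "is_unit A \<or> is_unit B"
  proof
    assume "p dvd coeff A 0"
    from key[OF P this] show ?thesis using unit[of B A] P by (simp add: mult.commute)
  next
    assume "p dvd coeff B 0"
    hence "degree A = 0" using key[of B A] P by (simp add: mult.commute)
    thus ?thesis using unit[of A B] P by simp
  qed
qed

text \<open>
  The cyclotomic polynomial of order p^k, as the geometric sum (Y^p - 1) / (Y - 1) in
  Y = X^(p^(k-1)); it is meant for k > 0 only.
\<close>

definition cyclo :: "nat \<Rightarrow> nat \<Rightarrow> int poly" where
  "cyclo p k = (\<Sum>i<p. monom 1 (i * p ^ (k - 1)))"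

lemma cyclo_mult:
  assumes "p > 0" "k > 0"
  shows "cyclo p k * (monom 1 (p ^ (k - 1)) - 1) = monom 1 (p ^ k) - 1"
proof -
  let ?Y = "monom 1 (p ^ (k - 1)) :: int poly"
  have "p ^ k = p * p ^ (k - 1)" using assms by (cases k) auto
  hence "monom 1 (p ^ k) = ?Y ^ p" by (simp add: monom_power mult.commute)
  moreover have "cyclo p k = (\<Sum>i<p. ?Y ^ i)"
    by (simp add: cyclo_def monom_power mult.commute)
  ultimately show ?thesis
    by (simp add: power_diff_1_eq mult.commute)
qed

lemma poly_cyclo_1: "poly (cyclo p k) 1 = int p"
  by (simp add: cyclo_def poly_sum poly_monom)

lemma degree_cyclo:
  assumes "p > 0" "k > 0"
  shows "degree (cyclo p k) = (p - 1) * p ^ (k - 1)" and "lead_coeff (cyclo p k) = 1"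
proof -
  let ?N = "p ^ (k - 1)"
  have N: "?N > 0" using assms by simp
  have mono: "i * ?N \<le> (p - 1) * ?N" if "i < p" for i
    using that by (intro mult_right_mono) auto
  have "coeff (cyclo p k) ((p - 1) * ?N) = (\<Sum>i<p. if i = p - 1 then 1 else 0)"
    using N by (auto simp: cyclo_def coeff_sum intro!: sum.cong)
  also have "\<dots> = 1" using assms by simp
  finally have lc: "coeff (cyclo p k) ((p - 1) * ?N) = 1" .
  have "degree (cyclo p k) \<le> (p - 1) * ?N"
    unfolding cyclo_def by (intro degree_sum_le) (auto intro: order.trans[OF degree_monom_le] mono)
  moreover have "degree (cyclo p k) \<ge> (p - 1) * ?N"
    using lc by (intro le_degree) auto
  ultimately show deg: "degree (cyclo p k) = (p - 1) * ?N" by simp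
  show "lead_coeff (cyclo p k) = 1" using lc deg by simp
qed

lemma irreducible_pcompose_shift:
  fixes P :: "int poly"
  assumes "irreducible (pcompose P [:1, 1:])"
  shows "irreducible P"
proof (rule irreducibleI)
  let ?s = "\<lambda>A::int poly. pcompose A [:1, 1:]"
  show "P \<noteq> 0" using assms by auto
  have unit: "is_unit A \<longleftrightarrow> is_unit (?s A)" for A :: "int poly"
  proof -
    have "is_unit A \<longleftrightarrow> degree A = 0 \<and> is_unit (coeff A 0)"
      for A :: "int poly" by (auto simp: is_unit_poly_iff elim!: degree_eq_zeroE)
    moreover have "degree A = 0 \<Longrightarrow> ?s A = A" by (auto elim!: degree_eq_zeroE)
    moreover have "degree (?s A) = degree A" by (simp add: degree_pcompose)
    ultimately show ?thesis by metis
  qed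
  show "\<not> is_unit P" using assms unit by (auto simp: irreducible_def)
  fix A B assume "P = A * B"
  hence "?s P = ?s A * ?s B" by (simp add: pcompose_mult)
  thus "is_unit A \<or> is_unit B" using assms unit irreducibleD by blast
qed

text \<open>
  Modulo p, \<open>cyclo_mult\<close> shifted to X + 1 becomes P * X^N = X^(p*N) with N = p^(k-1), so P is
  congruent to a power of X, while its constant coefficient is the value p of the cyclotomic
  polynomial at 1.
\<close>

lemma irreducible_cyclo:
  assumes p: "prime p" and k: "k > 0"
  shows "irreducible (cyclo p k)"
proof (rule irreducible_pcompose_shift)
  let ?N = "p ^ (k - 1)"
  let ?X1 = "[:1, 1:] :: int poly"
  let ?P = "pcompose (cyclo p k) ?X1"
  let ?d = "(p - 1) * ?N"
  have p1: "p > 1" using p prime_gt_1_nat by blast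
  have p0: "p > 0" using p1 by simp
  have deg: "degree ?P = ?d" using degree_cyclo(1)[OF p0 k] by (simp add: degree_pcompose)
  have lc: "lead_coeff ?P = 1"
    using degree_cyclo[OF p0 k] by (subst lead_coeff_comp) auto
  have pk: "p ^ k = ?d + ?N"
    using k p1 by (cases k) (auto simp: algebra_simps)
  from power_X_plus_1_cong[OF p, of "k - 1"] obtain U where
    U: "?X1 ^ ?N - monom 1 ?N - 1 = of_nat p * U" by (elim dvdE)
  from power_X_plus_1_cong[OF p, of k] obtain V where
    V: "?X1 ^ (p ^ k) - monom 1 (p ^ k) - 1 = of_nat p * V" by (elim dvdE)
  have mono: "pcompose (monom 1 m) ?X1 = ?X1 ^ m" for m
  proof (induction m)
    case 0
    show ?case by (simp add: monom_0 pcompose_1 flip: one_pCons)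
  next
    case (Suc m)
    thus ?case by (simp add: monom_Suc pcompose_pCons)
  qed
  have "pcompose (cyclo p k * (monom 1 ?N - 1)) ?X1 = pcompose (monom 1 (p ^ k) - 1) ?X1"
    using cyclo_mult[OF p0 k] by simp
  hence "?P * (?X1 ^ ?N - 1) = ?X1 ^ (p ^ k) - 1"
    by (simp add: pcompose_mult pcompose_diff mono pcompose_1)
  moreover have "?X1 ^ ?N - 1 = monom 1 ?N + of_nat p * U" using U by (simp add: algebra_simps)
  moreover have "?X1 ^ (p ^ k) - 1 = monom 1 (p ^ k) + of_nat p * V" using V by (simp add: algebra_simps)
  ultimately have eq: "monom 1 ?N * ?P = monom 1 (p ^ k) + of_nat p * (V - ?P * U)"
    by (simp add: algebra_simps)
  have coeffs: "coeff ?P i = (if i = ?d then 1 else 0) + int p * coeff (V - ?P * U) i'" if "i' = ?N + i" for i i'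
  proof -
    have "coeff ?P i = coeff (monom 1 ?N * ?P) i'" by (simp add: coeff_monom_mult that)
    also have "\<dots> = coeff (monom 1 (p ^ k)) i' + coeff (of_nat p * (V - ?P * U)) i'"
      by (subst eq) simp
    also have "coeff (of_nat p * (V - ?P * U)) i' = int p * coeff (V - ?P * U) i'"
      by (simp add: of_nat_poly)
    also have "coeff (monom 1 (p ^ k)) i' = (if i = ?d then 1 else (0::int))"
      by (auto simp: pk that)
    finally show ?thesis .
  qed
  show "irreducible ?P"
  proof (rule eisenstein_monic[where p = "int p"])
    show "prime (int p)" using p by simp
    show "lead_coeff ?P = 1" by (fact lc)
    show "degree ?P > 0" using p1 deg by simp
    show "int p dvd coeff ?P i" if "i < degree ?P" for i
      using that deg by (subst coeffs[OF refl]) simp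
    have "coeff ?P 0 = int p"
      unfolding poly_0_coeff_0 [symmetric] poly_pcompose by (simp add: poly_cyclo_1)
    moreover have "\<not> int p ^ 2 dvd int p"
    proof
      assume "int p ^ 2 dvd int p"
      hence "int p * int p dvd int p * 1" by (simp add: power2_eq_square)
      hence "int p dvd 1" using p0 by (subst (asm) dvd_mult_cancel_left) simp
      thus False using p1 by simp
    qed
    ultimately show "\<not> int p ^ 2 dvd coeff ?P 0" by simp
  qed
qed

section \<open>Roots of unity and the character sums over them\<close>

lemma zeta_cis: "zeta m = cis (2 * pi / real m)"
  by (simp add: zeta_def cis_conv_exp mult_ac)

lemma zeta_power_cis: "zeta m ^ j = cis (2 * pi * real j / real m)"
  by (simp add: zeta_cis Complex.DeMoivre mult_ac)

lemma norm_zeta [simp]: "cmod (zeta m) = 1"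
  by (simp add: zeta_cis)

lemma zeta_nonzero [simp]: "zeta m \<noteq> 0"
  using norm_zeta[of m] by (metis norm_zero zero_neq_one)

lemma cnj_zeta: "cnj (zeta m) = inverse (zeta m)"
  by (simp add: zeta_cis cis_cnj)

lemma zeta_power_eq_1_iff: "m > 0 \<Longrightarrow> zeta m ^ j = 1 \<longleftrightarrow> m dvd j"
  using complex_root_unity_eq_1[of m j]
  by (simp add: zeta_power_cis cis_conv_exp mult_ac)

lemma zeta_power_self [simp]: "m > 0 \<Longrightarrow> zeta m ^ m = 1"
  by (simp add: zeta_power_eq_1_iff)

lemma zeta_mult_power: "a > 0 \<Longrightarrow> zeta (a * b) ^ a = zeta b"
  by (simp add: zeta_cis Complex.DeMoivre)

lemma zeta_power_mod: "m > 0 \<Longrightarrow> zeta m ^ (j mod m) = zeta m ^ j"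
proof -
  assume m: "m > 0"
  have "zeta m ^ j = zeta m ^ (m * (j div m) + j mod m)" by simp
  also have "\<dots> = zeta m ^ (j mod m)"
    using m by (simp only: power_add power_mult) simp
  finally show ?thesis by simp
qed

lemma zeta_powi_mod: "m > 0 \<Longrightarrow> zeta m powi (j mod int m) = zeta m powi j"
proof -
  assume m: "m > 0"
  have "zeta m powi j = zeta m powi (int m * (j div int m) + j mod int m)" by simp
  also have "\<dots> = (zeta m powi int m) powi (j div int m) * zeta m powi (j mod int m)"
    by (simp only: power_int_add power_int_mult zeta_nonzero simp_thms)
  also have "zeta m powi int m = 1" using m by simp
  finally show ?thesis by simp
qed

lemma zeta_powi_eq_power: "m > 0 \<Longrightarrow> zeta m powi j = zeta m ^ nat (j mod int m)"
  using zeta_powi_mod[of m j] by (simp flip: power_int_of_nat)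

lemma zeta_powi_eq_1_iff:
  assumes m: "m > 0"
  shows "zeta m powi j = 1 \<longleftrightarrow> int m dvd j"
proof -
  have "j mod int m < int m" "j mod int m \<ge> 0" using m by auto
  hence "m dvd nat (j mod int m) \<longleftrightarrow> j mod int m = 0"
    using nat_dvd_not_less[of "nat (j mod int m)" m] by (cases "j mod int m = 0") auto
  thus ?thesis using m by (simp add: zeta_powi_eq_power zeta_power_eq_1_iff dvd_eq_mod_eq_0)
qed

lemma zeta_power_inj: "inj_on (\<lambda>a. zeta m ^ a) {..<m}"
proof (rule inj_onI)
  fix a b assume "a \<in> {..<m}" "b \<in> {..<m}" "zeta m ^ a = zeta m ^ b"
  thus "a = b"
  proof (induction a b rule: linorder_wlog)
    case (le a b)
    have "zeta m ^ b = zeta m ^ a * zeta m ^ (b - a)" using le(1) by (simp flip: power_add)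
    hence "zeta m ^ (b - a) = 1" using le by simp
    hence "m dvd b - a" using le by (subst (asm) zeta_power_eq_1_iff) auto
    moreover have "b - a < m" using le by (auto intro: le_less_trans[OF diff_le_self])
    ultimately have "\<not> 0 < b - a" using nat_dvd_not_less by blast
    thus ?case using le(1) by simp
  qed auto
qed

lemma sum_powers_root_of_unity:
  assumes "w ^ m = (1 :: complex)"
  shows "(\<Sum>a<m. w ^ a) = (if w = 1 then of_nat m else 0)"
  using assms by (auto simp: sum_gp_strict)

section \<open>Conjugation of roots of unity of prime power order\<close>

lemma poly_root_prod_dvd:
  fixes P :: "'a :: field poly"
  assumes "finite A" "\<And>z. z \<in> A \<Longrightarrow> poly P z = 0"
  shows "(\<Prod>z\<in>A. [:- z, 1:]) dvd P"
  using assms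
proof (induction A)
  case (insert a A)
  then obtain Q where Q: "P = (\<Prod>z\<in>A. [:- z, 1:]) * Q" by (auto elim: dvdE)
  have "poly P a = 0" using insert by auto
  moreover have "poly (\<Prod>z\<in>A. [:- z, 1:]) a \<noteq> 0"
    using insert by (auto simp: poly_prod)
  ultimately have "poly Q a = 0" using Q by simp
  hence "[:- a, 1:] dvd Q" by (simp add: poly_eq_0_iff_dvd)
  hence "[:- a, 1:] * (\<Prod>z\<in>A. [:- z, 1:]) dvd P"
    unfolding Q by (subst mult.commute) (intro mult_dvd_mono dvd_refl)
  thus ?case using insert by simp
qed auto

locale odd_prime_power =
  fixes p k :: nat
  assumes p: "prime p" and odd: "odd p" and k: "k > 0"
begin

abbreviation "q \<equiv> p ^ k"
abbreviation "z \<equiv> zeta q"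
definition "N = p ^ (k - 1)"

lemma p_gt_0 [simp]: "p > 0" and p_gt_1: "p > 1"
  using p prime_gt_1_nat[of p] by auto

lemma q_gt_0 [simp]: "q > 0" using p_gt_0 by simp
lemma N_gt_0 [simp]: "N > 0" using p_gt_0 by (simp add: N_def)
lemma q_eq: "q = p * N" using power_Suc[of p "k - 1"] k by (simp add: N_def del: power_Suc)
lemma q_gt_1: "q > 1" using k p_gt_1 by (intro one_less_power)

lemma coprime_q_iff: "coprime a q \<longleftrightarrow> \<not> p dvd a"
proof -
  have "coprime a q \<longleftrightarrow> coprime p a" using k by (simp add: coprime_commute)
  also have "\<dots> \<longleftrightarrow> \<not> p dvd a"
    using p prime_imp_coprime[of p a] by (auto dest: coprime_common_divisor)
  finally show ?thesis .
qed

lemma ipoly_cyclo_conjugate: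
  assumes "\<not> p dvd a"
  shows "ipoly (cyclo p k) (z ^ a) = 0"
proof -
  have "ipoly (cyclo p k * (monom 1 N - 1)) (z ^ a) = ipoly (monom 1 q - 1) (z ^ a)"
    by (simp only: N_def cyclo_mult[OF p_gt_0 k])
  hence "ipoly (cyclo p k) (z ^ a) * ((z ^ a) ^ N - 1) = (z ^ a) ^ q - 1" by simp
  also have "(z ^ a) ^ q = (z ^ q) ^ a" by (simp only: power_mult [symmetric] mult.commute)
  also have "z ^ q = 1" by simp
  finally have "ipoly (cyclo p k) (z ^ a) = 0 \<or> z ^ (a * N) = 1"
    by (simp add: power_mult)
  moreover have "\<not> q dvd a * N" using assms by (simp add: q_eq)
  ultimately show ?thesis by (simp add: zeta_power_eq_1_iff)
qed

text \<open>
  Let A be an annihilator of zeta of least degree. Dividing the cyclotomic polynomial \<Phi> by A over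
  the rationals leaves no remainder, so \<Phi> divides A * Q for some Q up to an integer factor. As \<Phi> is prime in
  \<int>[X], it divides A or Q, and it cannot divide Q because A is not constant. Hence no
  annihilator has smaller degree than \<Phi>, and since \<Phi> is monic, division by it
  is possible over the integers.
\<close>

lemma cyclo_dvd_if_ipoly_0:
  assumes P: "ipoly P z = 0"
  shows "cyclo p k dvd P"
proof (cases "P = 0")
  case False
  let ?C = "cyclo p k"
  have prime: "prime_elem ?C"
    using irreducible_cyclo[OF p k] by (rule irreducible_imp_prime_elem)
  have deg: "degree ?C > 0" using degree_cyclo(1)[OF p_gt_0 k] p_gt_1 by simp
  have C0: "?C \<noteq> 0" "ipoly ?C z = 0"
    using deg p_gt_1 ipoly_cyclo_conjugate[of 1] by auto
  define Ann where "Ann = (\<lambda>A. A \<noteq> 0 \<and> ipoly A z = 0)"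
  obtain A where A: "Ann A" and min: "\<And>B. Ann B \<Longrightarrow> degree A \<le> degree B"
    using ex_has_least_nat[of Ann P degree] False P by (auto simp: Ann_def)
  have A0: "A \<noteq> 0" "ipoly A z = 0" using A by (auto simp: Ann_def)
  from pseudo_mod[OF A0(1), of ?C] obtain a Q where
    a: "a \<noteq> 0" and eq: "smult a ?C = A * Q + pseudo_mod ?C A"
    and rem: "pseudo_mod ?C A = 0 \<or> degree (pseudo_mod ?C A) < degree A" by blast
  have "ipoly (pseudo_mod ?C A) z = 0"
    using arg_cong[OF eq, of "\<lambda>P. ipoly P z"] A0 C0 by simp
  hence "pseudo_mod ?C A = 0"
    using rem min[of "pseudo_mod ?C A"] unfolding Ann_def by linarith
  hence eq: "smult a ?C = A * Q" using eq by simp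
  have "?C dvd A * Q" by (simp flip: eq) (simp add: dvd_smult)
  hence "?C dvd A"
  proof (subst (asm) prime_elem_dvd_mult_iff[OF prime], elim disjE)
    assume "?C dvd Q"
    then obtain D where D: "Q = ?C * D" by (elim dvdE)
    have "?C * [:a:] = ?C * (A * D)" using eq D by (simp add: mult_ac)
    hence "[:a:] = A * D" using C0 by (simp only: mult_cancel_left) simp
    hence "ipoly [:a:] z = 0" using A0 by (simp only: ipoly_mult mult_zero_left)
    thus ?thesis using a by simp
  qed
  hence "degree ?C \<le> degree A" using A0 by (intro dvd_imp_degree_le) auto
  obtain Q' R where "pseudo_divmod P ?C = (Q', R)" by fastforce
  from pseudo_divmod[OF C0(1) this] degree_cyclo(2)[OF p_gt_0 k]
  have PQ: "P = ?C * Q' + R" and R: "R = 0 \<or> degree R < degree ?C" by auto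
  have "ipoly R z = 0" using arg_cong[OF PQ, of "\<lambda>P. ipoly P z"] P C0 by simp
  hence "R = 0" using R min[of R] \<open>degree ?C \<le> degree A\<close> unfolding Ann_def by linarith
  thus ?thesis using PQ by simp
qed auto

text \<open>
  This is the well-definedness of the field automorphism zeta \<mapsto> zeta^a, in the only form in
  which it is needed below.
\<close>

lemma ipoly_conjugate_0:
  assumes "ipoly P z = 0" "\<not> p dvd a"
  shows "ipoly P (z ^ a) = 0"
  using cyclo_dvd_if_ipoly_0[OF assms(1)] ipoly_cyclo_conjugate[OF assms(2)] by (auto elim!: dvdE)

lemma ipoly_conjugate_eq:
  assumes "ipoly P z = ipoly Q z" "\<not> p dvd a"
  shows "ipoly P (z ^ a) = ipoly Q (z ^ a)"
  using ipoly_conjugate_0[of "P - Q" a] assms by simp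

text \<open>
  The factorisation of the cyclotomic polynomial into linear factors over its roots, evaluated at 1.
\<close>

lemma prod_one_minus_conjugates: "of_nat p = (\<Prod>a\<in>totatives q. 1 - z ^ a)"
proof -
  let ?C = "map_poly of_int (cyclo p k) :: complex poly"
  let ?R = "(\<lambda>a. z ^ a) ` totatives q"
  have inj: "inj_on (\<lambda>a. z ^ a) (totatives q)"
    by (rule inj_on_subset[OF zeta_power_inj]) (use q_gt_1 totatives_less in auto)
  have lc: "coeff ?C (degree (cyclo p k)) = 1"
    using degree_cyclo(2)[OF p_gt_0 k] by (simp add: coeff_map_poly)
  have degC: "degree ?C = degree (cyclo p k)" by (rule degree_map_poly) auto
  have "poly ?C (z ^ a) = 0" if "a \<in> totatives q" for a
    using that ipoly_cyclo_conjugate[of a] coprime_q_iff[of a] by (simp add: ipoly_def in_totatives_iff)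
  hence "(\<Prod>x\<in>?R. [:- x, 1:]) dvd ?C" by (intro poly_root_prod_dvd) auto
  then obtain D where D: "?C = (\<Prod>x\<in>?R. [:- x, 1:]) * D" by (elim dvdE)
  have "card (totatives q) = degree ?C"
    using totient_prime_power[OF p k] degree_cyclo(1)[OF p_gt_0 k] by (simp add: totient_def degC mult.commute)
  hence degR: "degree (\<Prod>x\<in>?R. [:- x, 1:]) = degree ?C"
    by (subst degree_prod_sum_eq) (auto simp: card_image[OF inj])
  have C0: "?C \<noteq> 0" using lc by auto
  hence "D \<noteq> 0" "(\<Prod>x\<in>?R. [:- x, 1:]) \<noteq> 0" using D by auto
  hence "degree D = 0" using degR D degree_mult_eq[of "\<Prod>x\<in>?R. [:- x, 1:]" D] by simp
  moreover have "lead_coeff (\<Prod>x\<in>?R. [:- x, 1:]) = 1" by (simp add: lead_coeff_prod)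
  hence "lead_coeff D = 1" using arg_cong[OF D, of lead_coeff] lc degC by (simp only: lead_coeff_mult) simp
  ultimately have "D = 1" by (metis degree_eq_zeroE lead_coeff_pCons(2) one_pCons)
  hence "poly ?C 1 = (\<Prod>x\<in>?R. 1 - x)" using D by (simp add: poly_prod)
  also have "\<dots> = (\<Prod>a\<in>totatives q. 1 - z ^ a)" by (subst prod.reindex[OF inj]) simp
  also have "poly ?C 1 = of_nat p"
    by (simp add: ipoly_def [symmetric] cyclo_def)
  finally show ?thesis .
qed

end

section \<open>The ring generated by a complex number\<close>

text \<open>
  The ring \<int>[w]; adjunction is over the integers.
\<close>

definition adjoin :: "complex \<Rightarrow> complex set" where
  "adjoin w = range (\<lambda>P. ipoly P w)"

lemma adjoin_ipoly [intro, simp]: "ipoly P w \<in> adjoin w" by (auto simp: adjoin_def)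

lemma adjoin_of_int [simp]: "of_int a \<in> adjoin w"
  using adjoin_ipoly[of "[:a:]" w] by simp
lemma adjoin_0 [simp]: "0 \<in> adjoin w" and adjoin_1 [simp]: "1 \<in> adjoin w"
  using adjoin_of_int[of 0 w] adjoin_of_int[of 1 w] by simp_all
lemma adjoin_gen [simp]: "w \<in> adjoin w"
  using adjoin_ipoly[of "[:0, 1:]" w] by simp
lemma adjoin_add [simp]: "x \<in> adjoin w \<Longrightarrow> y \<in> adjoin w \<Longrightarrow> x + y \<in> adjoin w"
  unfolding adjoin_def using ipoly_add[symmetric] by fastforce
lemma adjoin_mult [simp]: "x \<in> adjoin w \<Longrightarrow> y \<in> adjoin w \<Longrightarrow> x * y \<in> adjoin w"
  unfolding adjoin_def using ipoly_mult[symmetric] by fastforce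
lemma adjoin_uminus [simp]: "x \<in> adjoin w \<Longrightarrow> - x \<in> adjoin w"
  unfolding adjoin_def using ipoly_uminus[symmetric] by fastforce
lemma adjoin_diff [simp]: "x \<in> adjoin w \<Longrightarrow> y \<in> adjoin w \<Longrightarrow> x - y \<in> adjoin w"
  unfolding adjoin_def using ipoly_diff[symmetric] by fastforce
lemma adjoin_power [simp]: "x \<in> adjoin w \<Longrightarrow> x ^ j \<in> adjoin w"
  by (induction j) auto
lemma adjoin_sum: "(\<And>i. i \<in> I \<Longrightarrow> f i \<in> adjoin w) \<Longrightarrow> sum f I \<in> adjoin w"
  by (induction I rule: infinite_finite_induct) auto
lemma adjoin_prod: "(\<And>i. i \<in> I \<Longrightarrow> f i \<in> adjoin w) \<Longrightarrow> prod f I \<in> adjoin w"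
  by (induction I rule: infinite_finite_induct) auto

lemma adjoin_mono: "w \<in> adjoin v \<Longrightarrow> adjoin w \<subseteq> adjoin v"
  unfolding adjoin_def using ipoly_pcompose[symmetric] by fastforce

lemma adjoin_dvd_prod:
  assumes "finite A" "\<And>a. a \<in> A \<Longrightarrow> \<exists>r\<in>adjoin w. f a = g a * r"
  shows "\<exists>r\<in>adjoin w. prod f A = prod g A * r"
proof -
  from assms(2) obtain r where r: "\<And>a. a \<in> A \<Longrightarrow> r a \<in> adjoin w \<and> f a = g a * r a" by metis
  have "prod f A = prod g A * prod r A"
    using r by (simp add: prod.distrib [symmetric] cong: prod.cong)
  thus ?thesis by (rule bexI) (simp add: r adjoin_prod)
qed

lemma zeta_orthogonality:
  assumes ij: "i < m" "j < m"
  shows "(\<Sum>a<m. (zeta m ^ i * cnj (zeta m) ^ j) ^ a) = (if i = j then of_nat m else 0)"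
proof -
  let ?w = "zeta m"
  have cnj: "cnj ?w ^ i * ?w ^ i = 1" for i
    by (simp add: cnj_zeta flip: power_mult_distrib)
  have "?w ^ i * cnj ?w ^ j = 1 \<longleftrightarrow> ?w ^ i * cnj ?w ^ j * ?w ^ j = ?w ^ j" by simp
  also have "?w ^ i * cnj ?w ^ j * ?w ^ j = ?w ^ i"
    using cnj[of j] by (simp only: mult.assoc mult_1_right)
  also have "?w ^ i = ?w ^ j \<longleftrightarrow> i = j"
    using inj_on_eq_iff[OF zeta_power_inj] ij by auto
  finally have 1: "?w ^ i * cnj ?w ^ j = 1 \<longleftrightarrow> i = j" .
  have "(?w ^ i * cnj ?w ^ j) ^ m = (?w ^ m) ^ i * cnj (?w ^ m) ^ j"
    by (simp add: power_mult_distrib mult.commute flip: power_mult)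
  also have "\<dots> = 1" using ij by simp
  finally show ?thesis by (subst sum_powers_root_of_unity) (auto simp: 1)
qed

text \<open>
  Parseval's identity on the integers modulo m.
\<close>

lemma parseval_zeta:
  fixes c :: "nat \<Rightarrow> int"
  shows "(\<Sum>a<m. (cmod (\<Sum>i<m. of_int (c i) * zeta m ^ (a * i)))\<^sup>2) = real m * (\<Sum>i<m. (of_int (c i))\<^sup>2)"
proof -
  let ?w = "zeta m"
  have "complex_of_real (\<Sum>a<m. (cmod (\<Sum>i<m. of_int (c i) * ?w ^ (a * i)))\<^sup>2) =
     (\<Sum>a<m. (\<Sum>i<m. of_int (c i) * ?w ^ (a * i)) * (\<Sum>j<m. of_int (c j) * cnj ?w ^ (a * j)))"
    by (simp only: of_real_sum complex_norm_square cnj_sum complex_cnj_mult complex_cnj_of_int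
        complex_cnj_power)
  also have "\<dots> = (\<Sum>a<m. \<Sum>i<m. \<Sum>j<m. of_int (c i) * of_int (c j) * (?w ^ i * cnj ?w ^ j) ^ a)"
    by (simp add: sum_product power_mult_distrib mult_ac flip: power_mult)
  also have "\<dots> = (\<Sum>i<m. \<Sum>a<m. \<Sum>j<m. of_int (c i) * of_int (c j) * (?w ^ i * cnj ?w ^ j) ^ a)"
    by (rule sum.swap)
  also have "\<dots> = (\<Sum>i<m. \<Sum>j<m. \<Sum>a<m. of_int (c i) * of_int (c j) * (?w ^ i * cnj ?w ^ j) ^ a)"
    by (rule sum.cong[OF refl], rule sum.swap)
  also have "\<dots> = (\<Sum>i<m. \<Sum>j<m. of_int (c i) * of_int (c j) * (\<Sum>a<m. (?w ^ i * cnj ?w ^ j) ^ a))"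
    by (simp add: sum_distrib_left)
  also have "\<dots> = (\<Sum>i<m. \<Sum>j<m. if i = j then of_int (c i) * of_int (c j) * of_nat m else 0)"
    by (intro sum.cong refl) (auto simp: zeta_orthogonality)
  also have "\<dots> = complex_of_real (real m * (\<Sum>i<m. (of_int (c i))\<^sup>2))"
    by (simp add: sum_distrib_left power2_eq_square mult_ac)
  finally show ?thesis by (simp only: of_real_eq_iff)
qed

lemma sum_lessThan_mult:
  fixes f :: "nat \<Rightarrow> 'a :: comm_monoid_add"
  shows "(\<Sum>m<p * N. f m) = (\<Sum>r<N. \<Sum>j<p. f (r + j * N))"
proof -
  have "(\<Sum>m<p * N. f m) = (\<Sum>j<p. sum f {j * N..<j * N + N})"
    by (simp add: sum.nat_group)
  also have "\<dots> = (\<Sum>j<p. \<Sum>r<N. f (r + j * N))"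
  proof (rule sum.cong[OF refl])
    fix j
    show "sum f {j * N..<j * N + N} = (\<Sum>r<N. f (r + j * N))"
      using sum.shift_bounds_nat_ivl[of f 0 "j * N" N] by (simp add: atLeast0LessThan add.commute)
  qed
  also have "\<dots> = (\<Sum>r<N. \<Sum>j<p. f (r + j * N))" by (rule sum.swap)
  finally show ?thesis .
qed

section \<open>The prime above p\<close>

context odd_prime_power
begin

lemma z_power_mod: "z ^ (i mod q) = z ^ i"
  by (simp add: zeta_power_mod)

lemma cnj_z_power: "cnj (z ^ a) = (z ^ a) ^ (q - 1)"
proof -
  have "(z ^ a) ^ (q - 1) * z ^ a = (z ^ a) ^ q" by (rule power_minus_mult[OF q_gt_0])
  also have "\<dots> = (z ^ q) ^ a" by (simp only: power_mult [symmetric] mult.commute)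
  also have "\<dots> = cnj (z ^ a) * z ^ a"
    by (simp add: cnj_zeta flip: power_mult_distrib)
  finally show ?thesis by simp
qed

lemma cnj_ipoly: "cnj (ipoly P (z ^ a)) = ipoly (pcompose P (monom 1 (q - 1))) (z ^ a)"
  by (induction P) (simp_all add: pcompose_pCons cnj_z_power del: complex_cnj_power)

text \<open>
  The uniformiser: up to units, p is a power of it, and it divides an element P(zeta) if and only if p
  divides P(1). It is mapped to an associate by complex conjugation.
\<close>

definition \<pi> :: complex where "\<pi> = 1 - z"

lemma pi_adjoin [simp]: "\<pi> \<in> adjoin z" by (simp add: \<pi>_def)

lemma pi_nonzero: "\<pi> \<noteq> 0"
  using q_gt_1 zeta_power_eq_1_iff[of q 1] by (auto simp: \<pi>_def)

lemma cnj_pi: "cnj \<pi> * z = - \<pi>"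
  by (simp add: \<pi>_def cnj_zeta algebra_simps)

lemma pi_dvd_one_minus_power: "\<exists>r\<in>adjoin z. 1 - z ^ a = \<pi> * r"
proof (rule bexI)
  show "1 - z ^ a = \<pi> * (\<Sum>i<a. z ^ i)" unfolding \<pi>_def by (rule one_diff_power_eq)
  show "(\<Sum>i<a. z ^ i) \<in> adjoin z" by (intro adjoin_sum adjoin_power adjoin_gen)
qed

text \<open>
  If a * a' = 1 modulo q, then zeta = (zeta^a)^a', so the roles of zeta and zeta^a in the geometric
  sum can be exchanged.
\<close>

lemma one_minus_power_dvd_pi:
  assumes "\<not> p dvd a"
  shows "\<exists>r\<in>adjoin z. \<pi> = (1 - z ^ a) * r"
proof -
  have "coprime a q" using assms by (simp only: coprime_q_iff simp_thms)
  from cong_solve_coprime_nat[OF this] obtain a' where "[a * a' = 1] (mod q)" by auto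
  hence "z ^ (a * a') = z ^ 1"
    by (subst (1 2) z_power_mod [symmetric]) (simp add: cong_def)
  hence "\<pi> = 1 - (z ^ a) ^ a'" by (simp add: \<pi>_def power_mult)
  also have "\<dots> = (1 - z ^ a) * (\<Sum>i<a'. (z ^ a) ^ i)" by (rule one_diff_power_eq)
  finally show ?thesis by (rule bexI) (simp add: adjoin_sum)
qed

lemma p_associated_pi_power:
  obtains u v where "u \<in> adjoin z" "v \<in> adjoin z"
    "of_nat p = \<pi> ^ totient q * u" "\<pi> ^ totient q = of_nat p * v"
proof -
  have "\<exists>u\<in>adjoin z. (\<Prod>a\<in>totatives q. 1 - z ^ a) = (\<Prod>a\<in>totatives q. \<pi>) * u"
    using pi_dvd_one_minus_power by (intro adjoin_dvd_prod) auto
  moreover have "\<exists>v\<in>adjoin z. (\<Prod>a\<in>totatives q. \<pi>) = (\<Prod>a\<in>totatives q. 1 - z ^ a) * v"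
    using one_minus_power_dvd_pi coprime_q_iff by (intro adjoin_dvd_prod) (auto simp: in_totatives_iff)
  moreover have "(\<Prod>a\<in>totatives q. \<pi>) = \<pi> ^ totient q" by (simp add: totient_def)
  ultimately show ?thesis
    unfolding prod_one_minus_conjugates [symmetric] using that by metis
qed

text \<open>
  The residue ring modulo \<pi> is the field with p elements, reached by evaluating polynomials at 1.
  Left to right this uses that the cyclotomic polynomial has the value p at 1, and right to left that
  \<pi> divides p.
\<close>

lemma pi_dvd_ipoly_iff:
  "(\<exists>r\<in>adjoin z. ipoly W z = \<pi> * r) \<longleftrightarrow> int p dvd poly W 1"
proof
  assume "\<exists>r\<in>adjoin z. ipoly W z = \<pi> * r"
  then obtain Q where "ipoly W z = \<pi> * ipoly Q z" by (auto simp: adjoin_def)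
  hence "ipoly (W - [:1, -1:] * Q) z = 0" by (simp add: \<pi>_def algebra_simps)
  then obtain S where "W - [:1, -1:] * Q = cyclo p k * S"
    using cyclo_dvd_if_ipoly_0 by (blast elim: dvdE)
  hence "poly (W - [:1, -1:] * Q) 1 = poly (cyclo p k * S) 1" by simp
  thus "int p dvd poly W 1" by (simp add: poly_cyclo_1)
next
  assume "int p dvd poly W 1"
  then obtain s where s: "poly W 1 = int p * s" by (elim dvdE)
  have "[:-1, 1:] dvd W - [:poly W 1:]" by (simp flip: poly_eq_0_iff_dvd)
  then obtain Q where "W - [:poly W 1:] = [:-1, 1:] * Q" by (elim dvdE)
  hence "W = [:poly W 1:] + [:-1, 1:] * Q" by (simp add: algebra_simps)
  hence "ipoly W z = ipoly ([:poly W 1:] + [:-1, 1:] * Q) z" by simp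
  also have "\<dots> = of_nat p * of_int s - \<pi> * ipoly Q z" by (simp add: s \<pi>_def algebra_simps)
  finally have "ipoly W z = of_nat p * of_int s - \<pi> * ipoly Q z" .
  moreover obtain u v where u: "u \<in> adjoin z" "of_nat p = \<pi> ^ totient q * u"
    by (rule p_associated_pi_power)
  moreover have "\<pi> ^ totient q = \<pi> * \<pi> ^ (totient q - 1)"
    by (simp flip: power_Suc)
  ultimately have "ipoly W z = \<pi> * (\<pi> ^ (totient q - 1) * u * of_int s - ipoly Q z)"
    by (simp add: algebra_simps)
  thus "\<exists>r\<in>adjoin z. ipoly W z = \<pi> * r" by (rule bexI) (simp add: u(1))
qed

text \<open>
  An element and its complex conjugate have the same residue modulo \<pi>, namely P(1). Since the residue ring
  is a field, \<pi> divides \<gamma> as soon as it divides \<gamma> * cnj \<gamma>, and then the norm loses two factors \<pi>.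
\<close>

lemma pi_power_dvd_norm_imp:
  assumes "\<gamma> \<in> adjoin z" "r \<in> adjoin z" "\<gamma> * cnj \<gamma> = \<pi> ^ (2 * m) * r"
  shows "\<exists>s\<in>adjoin z. \<gamma> = \<pi> ^ m * s"
  using assms
proof (induction m arbitrary: \<gamma> r)
  case (Suc m)
  obtain P where P: "\<gamma> = ipoly P z" using Suc.prems by (auto simp: adjoin_def)
  let ?P' = "pcompose P (monom 1 (q - 1))"
  have "ipoly (P * ?P') z = \<pi> * (\<pi> ^ (2 * m + 1) * r)"
    using Suc.prems(3) cnj_ipoly[of P 1] P by (simp add: mult_ac)
  hence "int p dvd poly (P * ?P') 1"
    using Suc.prems(2) by (subst pi_dvd_ipoly_iff [symmetric]) (auto intro!: bexI)
  hence "int p dvd poly P 1 * poly P 1" by (simp add: poly_pcompose poly_monom)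
  hence "int p dvd poly P 1" using p by (simp add: prime_dvd_mult_iff)
  then obtain \<gamma>' where \<gamma>': "\<gamma>' \<in> adjoin z" "\<gamma> = \<pi> * \<gamma>'" using pi_dvd_ipoly_iff P by blast
  have "\<pi>\<^sup>2 * (\<gamma>' * cnj \<gamma>') = - (\<pi> * (cnj \<pi> * z) * (\<gamma>' * cnj \<gamma>'))"
    by (simp add: cnj_pi power2_eq_square)
  also have "\<dots> = - z * (\<gamma> * cnj \<gamma>)" by (simp add: \<gamma>' mult_ac)
  also have "\<dots> = \<pi>\<^sup>2 * (\<pi> ^ (2 * m) * (- z * r))"
    by (simp add: Suc.prems(3) power2_eq_square)
  finally have "\<gamma>' * cnj \<gamma>' = \<pi> ^ (2 * m) * (- z * r)"
    using pi_nonzero by (simp only: mult_cancel_left power_eq_0_iff simp_thms)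
  with Suc.IH[OF \<gamma>'(1), of "- z * r"] Suc.prems(2) obtain s where "s \<in> adjoin z" "\<gamma>' = \<pi> ^ m * s" by auto
  thus ?case using \<gamma>' by (auto simp: mult_ac intro!: bexI)
qed auto

text \<open>
  Divisibility by p^n is divisibility by a power of \<pi>, which the norm detects.
\<close>

lemma p_power_dvd_if_norm:
  assumes "\<gamma> \<in> adjoin z" "\<gamma> * cnj \<gamma> = of_nat p ^ (2 * n)"
  shows "\<exists>\<epsilon>\<in>adjoin z. \<gamma> = of_nat p ^ n * \<epsilon>"
proof -
  obtain u v where uv: "u \<in> adjoin z" "v \<in> adjoin z"
    "of_nat p = \<pi> ^ totient q * u" "\<pi> ^ totient q = of_nat p * v"
    by (rule p_associated_pi_power)
  have "\<gamma> * cnj \<gamma> = \<pi> ^ (2 * (totient q * n)) * u ^ (2 * n)"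
    unfolding assms(2) by (subst uv(3)) (simp add: power_mult_distrib mult_ac flip: power_mult)
  from pi_power_dvd_norm_imp[OF assms(1) _ this] obtain s where
    s: "s \<in> adjoin z" "\<gamma> = \<pi> ^ (totient q * n) * s" using uv(1) by auto
  have "\<gamma> = of_nat p ^ n * (v ^ n * s)"
    unfolding s(2) power_mult uv(4) by (simp add: power_mult_distrib mult_ac)
  thus ?thesis by (rule bexI) (simp add: uv s)
qed

end

section \<open>Elements of absolute value one\<close>

lemma balanced_residue:
  fixes a :: int
  assumes "odd p"
  shows "\<exists>s. 2 * \<bar>a + int p * s\<bar> < int p"
proof -
  obtain h where h: "int p = 2 * h + 1" using assms by (auto elim: oddE)
  define b where "b = (a + h) mod int p"
  have "int p > 0" using assms by (auto intro: Nat.gr0I)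
  hence "b \<ge> 0" "b < int p" by (simp_all add: b_def)
  hence "2 * \<bar>b - h\<bar> < int p" using h by (simp add: abs_if)
  moreover have "a + int p * (- ((a + h) div int p)) = b - h"
    unfolding b_def using minus_mult_div_eq_mod[of "a + h" "int p"] by (simp add: algebra_simps)
  ultimately show ?thesis by metis
qed

context odd_prime_power
begin

lemma z_power_N: "z ^ N = zeta p"
  using zeta_mult_power[of N p] by (simp add: q_eq mult.commute)

lemma z_power_p: "z ^ p = zeta N"
  using zeta_mult_power[of p N] by (simp add: q_eq)

lemma sum_less_q_split:
  fixes f :: "nat \<Rightarrow> 'a :: comm_monoid_add"
  shows "(\<Sum>m<q. f m) = (\<Sum>r<N. \<Sum>j<p. f (r + j * N))"
  unfolding q_eq by (rule sum_lessThan_mult)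

lemma adjoin_coordinates:
  assumes "x \<in> adjoin z"
  obtains c :: "nat \<Rightarrow> int" where "x = (\<Sum>m<q. of_int (c m) * z ^ m)"
proof -
  obtain P where P: "x = ipoly P z" using assms by (auto simp: adjoin_def)
  let ?c = "\<lambda>m. \<Sum>i | i \<le> degree P \<and> i mod q = m. coeff P i"
  have "x = (\<Sum>i\<le>degree P. of_int (coeff P i) * z ^ (i mod q))"
    by (simp add: P ipoly_altdef z_power_mod)
  also have "\<dots> = (\<Sum>m<q. \<Sum>i | i \<in> {..degree P} \<and> i mod q = m. of_int (coeff P i) * z ^ (i mod q))"
    by (rule sum.group [symmetric]) auto
  also have "\<dots> = (\<Sum>m<q. of_int (?c m) * z ^ m)"
    by (intro sum.cong refl) (simp add: sum_distrib_right)
  finally show ?thesis by (rule that)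
qed

text \<open>
  The q coordinates of an element are not unique: the sum of zeta^(r + j*N) over j < p vanishes, so
  all coordinates of a residue class modulo N may be changed by the same integer. The sum C over the
  class then changes by a multiple of p, and can be made smaller than p/2 in absolute value.
\<close>

lemma adjoin_balanced_coordinates:
  assumes "x \<in> adjoin z"
  obtains c :: "nat \<Rightarrow> int" where "x = (\<Sum>m<q. of_int (c m) * z ^ m)"
    and "\<And>r. r < N \<Longrightarrow> 2 * \<bar>\<Sum>j<p. c (r + j * N)\<bar> < int p"
proof -
  obtain c where c: "x = (\<Sum>m<q. of_int (c m) * z ^ m)"
    using adjoin_coordinates[OF assms] by blast
  have "\<forall>r. \<exists>s. 2 * \<bar>(\<Sum>j<p. c (r + j * N)) + int p * s\<bar> < int p"
    using balanced_residue[OF odd] by blast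
  then obtain s where s: "\<And>r. 2 * \<bar>(\<Sum>j<p. c (r + j * N)) + int p * s r\<bar> < int p" by metis
  define c' where "c' = (\<lambda>m. c m + s (m mod N))"
  have zp: "(\<Sum>j<p. zeta p ^ j) = 0"
    using sum_powers_root_of_unity[of "zeta p" p] zeta_power_eq_1_iff[of p 1] p_gt_1 by simp
  have "(\<Sum>m<q. of_int (s (m mod N)) * z ^ m) =
      (\<Sum>r<N. \<Sum>j<p. of_int (s ((r + j * N) mod N)) * z ^ (r + j * N))"
    by (rule sum_less_q_split)
  also have "\<dots> = (\<Sum>r<N. of_int (s r) * z ^ r * (\<Sum>j<p. zeta p ^ j))"
    unfolding sum_distrib_left
    by (intro sum.cong refl)
       (simp add: power_add z_power_N power_mult mult.commute[of _ N])
  also have "\<dots> = 0" by (simp add: zp)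
  finally have "x = (\<Sum>m<q. of_int (c' m) * z ^ m)"
    by (simp add: c'_def c algebra_simps sum.distrib)
  moreover have "2 * \<bar>\<Sum>j<p. c' (r + j * N)\<bar> < int p" if "r < N" for r
    using s[of r] that by (simp add: c'_def sum.distrib)
  ultimately show ?thesis by (rule that)
qed

text \<open>
  The trace form in coordinates. The sum over the exponents prime to p is the sum over all exponents
  minus the sum over the multiples of p, and Parseval's identity applies to both: on the multiples of
  p, the N-th roots of unity zeta^p occur, with the class sums as coordinates.
\<close>

lemma sum_norm_conjugates:
  fixes c :: "nat \<Rightarrow> int"
  defines "E \<equiv> \<lambda>a. \<Sum>m<q. of_int (c m) * z ^ (a * m)"
  shows "(\<Sum>a | a < q \<and> \<not> p dvd a. (cmod (E a))\<^sup>2) =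
     real q * (\<Sum>m<q. (of_int (c m))\<^sup>2) - real N * (\<Sum>r<N. (of_int (\<Sum>j<p. c (r + j * N)))\<^sup>2)"
proof -
  have "{..<q} = {a. a < q \<and> \<not> p dvd a} \<union> (\<lambda>a. p * a) ` {..<N}"
    by (auto simp: q_eq elim!: dvdE)
  moreover have "{a. a < q \<and> \<not> p dvd a} \<inter> (\<lambda>a. p * a) ` {..<N} = {}" by auto
  ultimately have "(\<Sum>a<q. (cmod (E a))\<^sup>2) =
      (\<Sum>a | a < q \<and> \<not> p dvd a. (cmod (E a))\<^sup>2) + (\<Sum>a\<in>(\<lambda>a. p * a) ` {..<N}. (cmod (E a))\<^sup>2)"
    by (simp add: sum.union_disjoint)
  also have "(\<Sum>a\<in>(\<lambda>a. p * a) ` {..<N}. (cmod (E a))\<^sup>2) = (\<Sum>a<N. (cmod (E (p * a)))\<^sup>2)"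
    by (subst sum.reindex) (use p_gt_1 in \<open>auto simp: inj_on_def\<close>)
  also have "\<dots> = (\<Sum>a<N. (cmod (\<Sum>r<N. of_int (\<Sum>j<p. c (r + j * N)) * zeta N ^ (a * r)))\<^sup>2)"
  proof (intro sum.cong refl)
    fix a
    have "E (p * a) = (\<Sum>r<N. \<Sum>j<p. of_int (c (r + j * N)) * z ^ (p * a * (r + j * N)))"
      unfolding E_def by (rule sum_less_q_split)
    also have "\<dots> = (\<Sum>r<N. of_int (\<Sum>j<p. c (r + j * N)) * zeta N ^ (a * r))"
    proof (intro sum.cong refl)
      fix r
      have "z ^ (p * a * (r + j * N)) = zeta N ^ (a * r)" for j
      proof -
        have "z ^ (p * a * (r + j * N)) = zeta N ^ (a * r) * (zeta N ^ N) ^ (a * j)"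
          unfolding z_power_p [symmetric]
          by (simp add: algebra_simps flip: power_mult power_add)
        thus ?thesis by simp
      qed
      thus "(\<Sum>j<p. of_int (c (r + j * N)) * z ^ (p * a * (r + j * N))) =
          of_int (\<Sum>j<p. c (r + j * N)) * zeta N ^ (a * r)"
        by (simp add: sum_distrib_right)
    qed
    finally show "(cmod (E (p * a)))\<^sup>2 =
      (cmod (\<Sum>r<N. of_int (\<Sum>j<p. c (r + j * N)) * zeta N ^ (a * r)))\<^sup>2" by simp
  qed
  also have "\<dots> = real N * (\<Sum>r<N. (of_int (\<Sum>j<p. c (r + j * N)))\<^sup>2)"
    by (rule parseval_zeta)
  also have "(\<Sum>a<q. (cmod (E a))\<^sup>2) = real q * (\<Sum>m<q. (of_int (c m))\<^sup>2)"
    unfolding E_def by (rule parseval_zeta)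
  finally show ?thesis by simp
qed

lemma card_non_multiples: "card {a. a < q \<and> \<not> p dvd a} = q - N"
proof -
  have "{a. a < q \<and> \<not> p dvd a} = {..<q} - (\<lambda>a. p * a) ` {..<N}"
    by (auto simp: q_eq elim!: dvdE)
  moreover have "card ((\<lambda>a. p * a) ` {..<N}) = N" by (subst card_image) (use p_gt_1 in \<open>auto simp: inj_on_def\<close>)
  moreover have "(\<lambda>a. p * a) ` {..<N} \<subseteq> {..<q}" by (auto simp: q_eq)
  ultimately show ?thesis by (simp add: card_Diff_subset)
qed

text \<open>
  Absolute value 1 is an equation between polynomials in zeta, because complex conjugation is
  zeta \<mapsto> zeta^(q-1); hence it is preserved by conjugation.
\<close>

lemma unimodular_conjugate:
  assumes "cmod (ipoly P z) = 1" "\<not> p dvd a"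
  shows "cmod (ipoly P (z ^ a)) = 1"
proof -
  let ?Q = "P * pcompose P (monom 1 (q - 1))"
  have norm: "ipoly ?Q (z ^ b) = of_real ((cmod (ipoly P (z ^ b)))\<^sup>2)" for b
    by (simp add: cnj_ipoly complex_norm_square del: ipoly_pcompose of_real_power)
  have "ipoly ?Q z = ipoly 1 z" using norm[of 1] assms by simp
  hence "ipoly ?Q (z ^ a) = ipoly 1 (z ^ a)" using assms(2) by (rule ipoly_conjugate_eq)
  hence "(cmod (ipoly P (z ^ a)))\<^sup>2 = 1" unfolding norm ipoly_1 by (simp only: of_real_eq_1_iff)
  thus ?thesis using power2_eq_imp_eq[of "cmod (ipoly P (z ^ a))" 1] by simp
qed

text \<open>
  Let S be the sum of the squares of balanced coordinates and C_r the class sums. All conjugates have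
  absolute value 1, so \<open>sum_norm_conjugates\<close> gives p * S - (sum of C_r^2) = p - 1. Balance
  bounds C_r^2 by (p-1)/2 times the part of S in class r: one factor |C_r| is at most (p-1)/2
  and the other at most the sum of squares, since |c| \<le> c^2 for integers. This leaves S < 2, and S
  is not 0, so exactly one coordinate is nonzero.
\<close>

theorem unimodular_in_adjoin_zeta:
  assumes "\<epsilon> \<in> adjoin z" "cmod \<epsilon> = 1"
  shows "\<exists>m. \<epsilon> = z ^ m \<or> \<epsilon> = - (z ^ m)"
proof -
  obtain c where c: "\<epsilon> = (\<Sum>m<q. of_int (c m) * z ^ m)"
    and bal: "\<And>r. r < N \<Longrightarrow> 2 * \<bar>\<Sum>j<p. c (r + j * N)\<bar> < int p"
    using adjoin_balanced_coordinates[OF assms(1)] by blast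
  let ?E = "\<Sum>m<q. monom (c m) m"
  define C where "C = (\<lambda>r. \<Sum>j<p. c (r + j * N))"
  define S where "S = (\<Sum>m<q. (c m)\<^sup>2)"
  have evE: "ipoly ?E (z ^ a) = (\<Sum>m<q. of_int (c m) * z ^ (a * m))" for a
    by (simp add: power_mult)
  have "cmod (ipoly ?E z) = 1" using assms(2) c by simp
  hence "cmod (\<Sum>m<q. of_int (c m) * z ^ (a * m)) = 1" if "\<not> p dvd a" for a
    using unimodular_conjugate[OF \<open>cmod (ipoly ?E z) = 1\<close> that] by (simp only: evE)
  hence "(\<Sum>a | a < q \<and> \<not> p dvd a. (cmod (\<Sum>m<q. of_int (c m) * z ^ (a * m)))\<^sup>2) = real (q - N)"
    by (simp add: card_non_multiples)
  hence "real (q - N) = real q * (\<Sum>m<q. (of_int (c m))\<^sup>2) - real N * (\<Sum>r<N. (of_int (C r))\<^sup>2)"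
    unfolding sum_norm_conjugates C_def by simp
  also have "\<dots> = real_of_int (int N * (int p * S - (\<Sum>r<N. (C r)\<^sup>2)))"
    by (simp add: S_def q_eq algebra_simps)
  also have "real (q - N) = real_of_int (int N * (int p - 1))"
    using p_gt_1 by (simp add: q_eq of_nat_diff algebra_simps)
  finally have "int N * (int p - 1) = int N * (int p * S - (\<Sum>r<N. (C r)\<^sup>2))"
    by (simp only: of_int_eq_iff)
  hence main: "int p - 1 = int p * S - (\<Sum>r<N. (C r)\<^sup>2)"
    using N_gt_0 by (simp only: mult_cancel_left of_nat_eq_0_iff) simp
  have split: "S = (\<Sum>r<N. \<Sum>j<p. (c (r + j * N))\<^sup>2)" unfolding S_def by (rule sum_less_q_split)
  have "2 * (C r)\<^sup>2 \<le> (int p - 1) * (\<Sum>j<p. (c (r + j * N))\<^sup>2)" if r: "r < N" for r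
  proof -
    have sq: "\<bar>a\<bar> \<le> a\<^sup>2" for a :: int
      using mult_left_mono[of 1 "\<bar>a\<bar>" "\<bar>a\<bar>"] by (cases "a = 0") (auto simp: power2_eq_square)
    have "\<bar>C r\<bar> \<le> (\<Sum>j<p. \<bar>c (r + j * N)\<bar>)" unfolding C_def by (rule sum_abs)
    also have "\<dots> \<le> (\<Sum>j<p. (c (r + j * N))\<^sup>2)" by (intro sum_mono sq)
    finally have 1: "\<bar>C r\<bar> \<le> (\<Sum>j<p. (c (r + j * N))\<^sup>2)" .
    have "2 * (C r)\<^sup>2 = (2 * \<bar>C r\<bar>) * \<bar>C r\<bar>" by (simp add: power2_eq_square)
    also have "\<dots> \<le> (int p - 1) * (\<Sum>j<p. (c (r + j * N))\<^sup>2)"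
      using bal[OF r] 1 p_gt_1 by (intro mult_mono) (auto simp: C_def)
    finally show ?thesis .
  qed
  hence "2 * (\<Sum>r<N. (C r)\<^sup>2) \<le> (int p - 1) * S"
    unfolding split sum_distrib_left by (intro sum_mono) auto
  with main have "(int p + 1) * S \<le> 2 * (int p - 1)" by (simp add: algebra_simps)
  moreover have "(int p + 1) * 2 \<le> (int p + 1) * S" if "S \<ge> 2"
    using that by (intro mult_left_mono) auto
  ultimately have "S < 2" by (cases "S \<ge> 2") auto
  moreover have "S \<noteq> 0"
  proof
    assume "S = 0"
    hence "int p - 1 = - (\<Sum>r<N. (C r)\<^sup>2)" using main by simp
    also have "\<dots> \<le> 0" by (simp add: sum_nonneg)
    finally show False using p_gt_1 by simp
  qed
  moreover have "S \<ge> 0" unfolding S_def by (intro sum_nonneg) auto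
  ultimately have S1: "S = 1" by simp
  have "\<exists>i<q. c i \<noteq> 0"
  proof (rule ccontr)
    assume "\<not> (\<exists>i<q. c i \<noteq> 0)"
    hence "S = 0" by (simp add: S_def)
    thus False using S1 by simp
  qed
  then obtain i where i: "i < q" "c i \<noteq> 0" by blast
  have "S = (c i)\<^sup>2 + (\<Sum>m\<in>{..<q} - {i}. (c m)\<^sup>2)" unfolding S_def using i by (intro sum.remove) auto
  moreover have "(c i)\<^sup>2 \<ge> 1" using i by (simp add: int_one_le_iff_zero_less)
  moreover have "(\<Sum>m\<in>{..<q} - {i}. (c m)\<^sup>2) \<ge> 0" by (intro sum_nonneg) auto
  ultimately have ci: "(c i)\<^sup>2 = 1" and rest: "(\<Sum>m\<in>{..<q} - {i}. (c m)\<^sup>2) = 0" using S1 by linarith+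
  have "\<forall>m\<in>{..<q} - {i}. c m = 0" using rest by (subst (asm) sum_nonneg_eq_0_iff) auto
  hence "\<epsilon> = of_int (c i) * z ^ i"
    unfolding c using i by (subst sum.remove[of _ i]) (auto intro!: sum.neutral)
  moreover have "c i = 1 \<or> c i = -1" using ci by (simp add: power2_eq_1_iff)
  ultimately show ?thesis by auto
qed

end

section \<open>Elements whose norm is a power of p\<close>

text \<open>
  In p = (product of 1 - w^a over 0 < a < p), the factors for a and p - a differ by the unit -w^(p-a).
  So p is, up to a sign and a power of w, the square of the product g over the first half. The power
  of w is itself a square, because h + 1 is half of p + 1 and w^(p+1) = w. This replaces the
  quadratic Gauss sum, from which it differs at most by a sign.
\<close>

lemma obtain_sqrt_signed_prime:
  assumes p: "prime p" and odd: "odd p"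
  obtains G where "G \<in> adjoin (zeta p)" "G\<^sup>2 = (-1) ^ ((p - 1) div 2) * of_nat p"
proof -
  interpret odd_prime_power p 1 using p odd by unfold_locales auto
  define h where "h = (p - 1) div 2"
  have h: "p = 2 * h + 1" using odd by (auto simp: h_def elim!: oddE)
  let ?w = "zeta p"
  define g where "g = (\<Prod>a\<in>{1..h}. 1 - ?w ^ a)"
  define T where "T = (\<Sum>a\<in>{1..h}. p - a)"
  have tot: "totatives p = {1..h} \<union> (\<lambda>a. p - a) ` {1..h}"
  proof -
    have "totatives p = {0<..<p}" using p by (rule totatives_prime)
    moreover have "a \<in> (\<lambda>a. p - a) ` {1..h}" if "a < p" "\<not> a \<le> h" for a
      using that h by (intro image_eqI[of _ _ "p - a"]) auto
    ultimately show ?thesis using h by force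
  qed
  have "of_nat p = (\<Prod>a\<in>totatives p. 1 - ?w ^ a)" using prod_one_minus_conjugates by simp
  also have "\<dots> = g * (\<Prod>a\<in>(\<lambda>a. p - a) ` {1..h}. 1 - ?w ^ a)"
    unfolding tot g_def by (rule prod.union_disjoint) (use h in auto)
  also have "(\<Prod>a\<in>(\<lambda>a. p - a) ` {1..h}. 1 - ?w ^ a) = (\<Prod>a\<in>{1..h}. 1 - ?w ^ (p - a))"
    by (subst prod.reindex) (use h in \<open>auto simp: inj_on_def\<close>)
  also have "\<dots> = (\<Prod>a\<in>{1..h}. - (?w ^ (p - a)) * (1 - ?w ^ a))"
  proof (intro prod.cong refl)
    fix a assume "a \<in> {1..h}"
    hence "?w ^ (p - a) * ?w ^ a = ?w ^ p" using h by (simp flip: power_add)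
    thus "1 - ?w ^ (p - a) = - (?w ^ (p - a)) * (1 - ?w ^ a)" by (simp add: algebra_simps)
  qed
  also have "\<dots> = (\<Prod>a\<in>{1..h}. - (?w ^ (p - a))) * g" by (simp only: g_def prod.distrib)
  also have "(\<Prod>a\<in>{1..h}. - (?w ^ (p - a))) = (-1) ^ h * ?w ^ T"
    by (simp add: prod_uminus T_def power_sum)
  finally have P: "of_nat p = (-1) ^ h * (?w ^ T * g\<^sup>2)" by (simp add: power2_eq_square mult_ac)
  \<comment> \<open>w^(T * (h + 1)) is a square root of w^T.\<close>
  define G where "G = ?w ^ (T * (h + 1)) * g"
  have "(?w ^ (T * (h + 1)))\<^sup>2 = ?w ^ T * (?w ^ p) ^ T"
    by (simp add: h algebra_simps flip: power_mult power_add)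
  hence "G\<^sup>2 = ?w ^ T * g\<^sup>2" by (simp add: G_def power_mult_distrib)
  also have "\<dots> = (-1) ^ h * of_nat p" by (simp add: P flip: mult.assoc power_mult_distrib)
  finally have "G\<^sup>2 = (-1) ^ ((p - 1) div 2) * of_nat p" by (simp add: h_def)
  moreover have "G \<in> adjoin ?w" unfolding G_def g_def
    by (intro adjoin_mult adjoin_prod adjoin_diff adjoin_power adjoin_gen adjoin_1)
  ultimately show ?thesis using that by blast
qed

context odd_prime_power
begin

text \<open>
  The product \<alpha> * G^n has norm p^(2n), so it is p^n times an element of absolute value 1,
  that is, p^n times a root of unity up to sign. Multiplying by G^n once more turns
  G^(2n) into \<plusminus>p^n, and p^n cancels.
\<close>

lemma norm_p_power_in_adjoin_zeta:
  assumes \<alpha>: "\<alpha> \<in> adjoin z" "(cmod \<alpha>)\<^sup>2 = real p ^ n"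
    and G: "G \<in> adjoin z" "G\<^sup>2 = \<sigma> * of_nat p" and \<sigma>: "\<sigma> \<in> {1, -1}"
  shows "\<exists>m. \<exists>s\<in>{1, -1}. \<alpha> = s * z ^ m * G ^ n"
proof -
  have "(cmod G)\<^sup>2 = real p" using arg_cong[OF G(2), of cmod] \<sigma> by (auto simp: norm_mult norm_power)
  hence norm: "(cmod (\<alpha> * G ^ n))\<^sup>2 = real p ^ (2 * n)"
  proof -
    have "(cmod (\<alpha> * G ^ n))\<^sup>2 = (cmod \<alpha>)\<^sup>2 * ((cmod G)\<^sup>2) ^ n"
      by (simp add: norm_mult norm_power power_mult_distrib mult.commute flip: power_mult)
    thus ?thesis using \<alpha>(2) \<open>(cmod G)\<^sup>2 = real p\<close> by (simp add: mult_2 power_add)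
  qed
  hence "(\<alpha> * G ^ n) * cnj (\<alpha> * G ^ n) = of_nat p ^ (2 * n)"
    by (simp only: complex_norm_square [symmetric]) simp
  then obtain \<epsilon> where \<epsilon>: "\<epsilon> \<in> adjoin z" "\<alpha> * G ^ n = of_nat p ^ n * \<epsilon>"
    using p_power_dvd_if_norm[of "\<alpha> * G ^ n" n] \<alpha>(1) G(1) by auto
  have "(real p ^ n * cmod \<epsilon>)\<^sup>2 = (real p ^ n)\<^sup>2"
    using norm unfolding \<epsilon>(2) by (simp add: norm_mult norm_power power_mult mult.commute)
  hence "real p ^ n * cmod \<epsilon> = real p ^ n" by (rule power2_eq_imp_eq) auto
  hence "cmod \<epsilon> = 1" using p_gt_1 by auto
  then obtain m where m: "\<epsilon> = z ^ m \<or> \<epsilon> = - (z ^ m)"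
    using unimodular_in_adjoin_zeta \<epsilon>(1) by blast
  have "G ^ n * G ^ n = \<sigma> ^ n * of_nat p ^ n"
    by (simp add: power_mult_distrib [symmetric] G(2) [symmetric] power2_eq_square)
  moreover have "\<alpha> * (G ^ n * G ^ n) = of_nat p ^ n * \<epsilon> * G ^ n"
    unfolding \<epsilon>(2) [symmetric] by (simp only: mult.assoc)
  ultimately have "of_nat p ^ n * (\<sigma> ^ n * \<alpha>) = of_nat p ^ n * (\<epsilon> * G ^ n)"
    by (simp only: mult_ac)
  hence "\<sigma> ^ n * \<alpha> = \<epsilon> * G ^ n" using p_gt_1 by simp
  moreover have "\<sigma> ^ n = 1 \<or> \<sigma> ^ n = -1" using \<sigma> by (cases "even n") auto
  ultimately have "\<alpha> = \<epsilon> * G ^ n \<or> - \<alpha> = \<epsilon> * G ^ n" by auto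
  hence "\<alpha> = \<epsilon> * G ^ n \<or> \<alpha> = - \<epsilon> * G ^ n" by (metis minus_minus mult_minus_left)
  with m show ?thesis by (intro exI[of _ m]) auto
qed

text \<open>
  The conjugations with exponent 1 + M*s fix \<int>[zeta_M] and multiply zeta^i by the i-th power of
  the root of unity zeta_L^s. The conjugates of the relation for s < L thus form a Fourier transform
  of the terms A_i * zeta^i, which must all vanish.
\<close>

lemma zeta_powers_independent:
  assumes q: "q = L * M" and M: "p dvd M"
    and A: "\<And>e. e < L \<Longrightarrow> A e \<in> adjoin (zeta M)"
    and sum0: "(\<Sum>e<L. A e * z ^ e) = 0" and e: "e < L"
  shows "A e = 0"
proof -
  have LM: "L > 0" "M > 0" using q q_gt_0 by (auto intro: Nat.gr0I simp del: q_gt_0)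
  have zL: "z ^ L = zeta M" using zeta_mult_power[of L M] LM q by simp
  have zM: "z ^ M = zeta L" using zeta_mult_power[of M L] LM q by (simp add: mult.commute)
  have "\<exists>Q. \<forall>e<L. A e = ipoly (Q e) (zeta M)"
    using A unfolding adjoin_def by (intro choice) blast
  then obtain Q where Q: "\<And>e. e < L \<Longrightarrow> A e = ipoly (Q e) (zeta M)" by blast
  \<comment> \<open>One integer polynomial represents the whole relation, so that it can be conjugated.\<close>
  let ?P = "\<Sum>e<L. pcompose (Q e) (monom 1 L) * monom 1 e"
  have P: "ipoly ?P w = (\<Sum>e<L. ipoly (Q e) (w ^ L) * w ^ e)" for w by simp
  have "ipoly ?P z = 0" unfolding P zL using sum0 Q by simp
  hence twisted: "(\<Sum>i<L. A i * z ^ i * (zeta L ^ i) ^ s) = 0" for s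
  proof -
    let ?a = "1 + M * s"
    have "\<not> p dvd ?a"
      using M p_gt_1 by (metis dvd_add_left_iff dvd_mult2 nat_dvd_1_iff_1 nat_neq_iff)
    with \<open>ipoly ?P z = 0\<close> have "ipoly ?P (z ^ ?a) = 0" by (rule ipoly_conjugate_0)
    hence "(\<Sum>i<L. ipoly (Q i) ((z ^ ?a) ^ L) * (z ^ ?a) ^ i) = 0" unfolding P .
    moreover have a1: "(z ^ ?a) ^ L = zeta M"
    proof -
      have "(z ^ ?a) ^ L = z ^ L * (zeta M ^ M) ^ s"
        unfolding zL [symmetric] by (simp add: algebra_simps flip: power_mult power_add)
      thus ?thesis using LM zL by simp
    qed
    moreover have a2: "(z ^ ?a) ^ i = z ^ i * (zeta L ^ i) ^ s" for i
      unfolding zM [symmetric] by (simp add: algebra_simps flip: power_mult power_add)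
    ultimately have "(\<Sum>i<L. ipoly (Q i) (zeta M) * (z ^ i * (zeta L ^ i) ^ s)) = 0" by (simp only:)
    thus ?thesis using Q by (simp add: mult.assoc)
  qed
  let ?w = "zeta L"
  have "0 = (\<Sum>s<L. cnj ?w ^ (e * s) * (\<Sum>i<L. A i * z ^ i * (?w ^ i) ^ s))"
    by (simp add: twisted)
  also have "\<dots> = (\<Sum>s<L. \<Sum>i<L. A i * z ^ i * (?w ^ i * cnj ?w ^ e) ^ s)"
    by (simp add: sum_distrib_left power_mult_distrib mult_ac flip: power_mult)
  also have "\<dots> = (\<Sum>i<L. \<Sum>s<L. A i * z ^ i * (?w ^ i * cnj ?w ^ e) ^ s)"
    by (rule sum.swap)
  also have "\<dots> = (\<Sum>i<L. A i * z ^ i * (\<Sum>s<L. (?w ^ i * cnj ?w ^ e) ^ s))"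
    by (simp add: sum_distrib_left)
  also have "\<dots> = (\<Sum>i<L. if i = e then A i * z ^ i * of_nat L else 0)"
    by (intro sum.cong refl) (auto simp: zeta_orthogonality e)
  also have "\<dots> = A e * z ^ e * of_nat L" using e by simp
  finally show ?thesis using LM by simp
qed

end

section \<open>Fourier inversion and digits on vectors over the integers modulo M\<close>

lemma zeta_powi_sum: "zeta m powi (\<Sum>i\<in>I. f i) = (\<Prod>i\<in>I. zeta m powi f i)"
  by (induction I rule: infinite_finite_induct) (auto simp: power_int_add)

lemma zeta_powi_adjoin: "m > 0 \<Longrightarrow> zeta m powi j \<in> adjoin (zeta m)"
  by (simp add: zeta_powi_eq_power)

lemma zeta_mult_powi: "a > 0 \<Longrightarrow> zeta (a * b) powi (int a * y) = zeta b powi y"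
  by (simp add: power_int_mult zeta_mult_power)

lemma adjoin_zeta_mono: "a > 0 \<Longrightarrow> adjoin (zeta b) \<subseteq> adjoin (zeta (a * b))"
  by (rule adjoin_mono) (metis adjoin_gen adjoin_power zeta_mult_power)

lemma finite_Zvec [simp]: "finite (Zvec m r)"
  by (auto simp: Zvec_def Zmod_eq intro!: finite_PiE)

lemma card_Zvec: "card (Zvec m r) = m ^ r"
  by (simp add: Zvec_def Zmod_eq card_PiE)

lemma Zmod_character_sum:
  assumes M: "M > 0"
  shows "(\<Sum>y\<in>Zmod M. zeta M powi (y * j)) = (if int M dvd j then of_nat M else 0)"
proof -
  have "Zmod M = int ` {..<M}" by (simp add: Zmod_eq image_int_atLeastLessThan lessThan_atLeast0)
  hence "(\<Sum>y\<in>Zmod M. zeta M powi (y * j)) = (\<Sum>a<M. zeta M powi (int a * j))"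
    by (simp add: sum.reindex)
  also have "\<dots> = (\<Sum>a<M. (zeta M powi j) ^ a)"
    by (intro sum.cong refl) (simp add: power_int_mult mult.commute[of _ j])
  also have "\<dots> = (if int M dvd j then of_nat M else 0)"
  proof (subst sum_powers_root_of_unity)
    have "(zeta M powi j) ^ M = zeta M powi (j * int M)" by (simp add: power_int_mult)
    also have "\<dots> = 1" using M by (subst zeta_powi_eq_1_iff) auto
    finally show "(zeta M powi j) ^ M = 1" .
  qed (use M in \<open>simp add: zeta_powi_eq_1_iff\<close>)
  finally show ?thesis .
qed

lemma Zvec_orthogonality:
  assumes M: "M > 0" and vw: "v \<in> Zvec M r" "w \<in> Zvec M r"
  shows "(\<Sum>c\<in>Zvec M r. zeta M powi (\<Sum>i=1..r. c i * (v i - w i))) =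
    (if v = w then of_nat M ^ r else 0)"
proof -
  have "(\<Sum>c\<in>Zvec M r. zeta M powi (\<Sum>i=1..r. c i * (v i - w i))) =
      (\<Prod>i=1..r. \<Sum>y\<in>Zmod M. zeta M powi (y * (v i - w i)))"
    unfolding Zvec_def zeta_powi_sum
    by (subst prod_sum_PiE) (auto simp: Zmod_eq)
  also have "\<dots> = (\<Prod>i=1..r. if v i = w i then of_nat M else 0)"
  proof (intro prod.cong refl)
    fix i assume "i \<in> {1..r}"
    hence "v i \<in> Zmod M" "w i \<in> Zmod M" using vw by (auto simp: Zvec_def)
    hence "int M dvd v i - w i \<longleftrightarrow> v i = w i"
      using dvd_imp_le_int[of "v i - w i" "int M"]
      by (cases "v i = w i") (auto simp: Zmod_eq abs_if split: if_splits)
    thus "(\<Sum>y\<in>Zmod M. zeta M powi (y * (v i - w i))) = (if v i = w i then of_nat M else 0)"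
      using M by (simp add: Zmod_character_sum)
  qed
  also have "\<dots> = (if v = w then of_nat M ^ r else 0)"
  proof (cases "v = w")
    case False
    then obtain i where "i \<in> {1..r}" "v i \<noteq> w i"
      using vw unfolding Zvec_def by (metis PiE_ext)
    hence "\<exists>i\<in>{1..r}. (if v i = w i then of_nat M else 0) = (0 :: complex)" by (intro bexI[of _ i]) auto
    thus ?thesis using False by (subst prod_zero) auto
  qed simp
  finally show ?thesis .
qed

text \<open>
  The right-hand side of the transform identity is the transform of the family that is K at d and 0
  elsewhere; the Fourier transform is injective by orthogonality of the characters.
\<close>

lemma Zvec_fourier_delta_iff:
  assumes M: "M > 0" and d: "d \<in> Zvec M r"
  shows "(\<forall>c\<in>Zvec M r. (\<Sum>v\<in>Zvec M r. A v * zeta M powi (\<Sum>i=1..r. c i * v i)) =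
            K * zeta M powi (\<Sum>i=1..r. c i * d i)) \<longleftrightarrow>
         (\<forall>v\<in>Zvec M r. A v = (if v = d then K else 0))"  (is "?L \<longleftrightarrow> ?R")
proof
  assume ?R
  hence "(\<Sum>v\<in>Zvec M r. A v * ch v) = (\<Sum>v\<in>Zvec M r. if v = d then K * ch v else 0)" for ch
    by (intro sum.cong) auto
  thus ?L using d by simp
next
  assume L: ?L
  let ?ch = "\<lambda>c v. zeta M powi (\<Sum>i=1..r. c i * v i)"
  have diff: "?ch c v * zeta M powi (- (\<Sum>i=1..r. c i * w i)) = zeta M powi (\<Sum>i=1..r. c i * (v i - w i))" for c v w
    by (simp flip: power_int_add add: sum_subtractf algebra_simps)
  show ?R
  proof
    fix w assume w: "w \<in> Zvec M r"
    have "(\<Sum>c\<in>Zvec M r. (\<Sum>v\<in>Zvec M r. A v * ?ch c v) * zeta M powi (- (\<Sum>i=1..r. c i * w i))) =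
        (\<Sum>c\<in>Zvec M r. \<Sum>v\<in>Zvec M r. A v * zeta M powi (\<Sum>i=1..r. c i * (v i - w i)))"
      by (simp only: sum_distrib_right mult.assoc diff)
    also have "\<dots> = (\<Sum>v\<in>Zvec M r. \<Sum>c\<in>Zvec M r. A v * zeta M powi (\<Sum>i=1..r. c i * (v i - w i)))"
      by (rule sum.swap)
    also have "\<dots> = (\<Sum>v\<in>Zvec M r. if v = w then A v * of_nat M ^ r else 0)"
      unfolding sum_distrib_left [symmetric]
    proof (intro sum.cong refl)
      fix v assume v: "v \<in> Zvec M r"
      show "A v * (\<Sum>c\<in>Zvec M r. zeta M powi (\<Sum>i=1..r. c i * (v i - w i))) =
          (if v = w then A v * of_nat M ^ r else 0)"
        by (subst Zvec_orthogonality[OF M v w]) simp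
    qed
    also have "\<dots> = A w * of_nat M ^ r" using w by simp
    finally have "A w * of_nat M ^ r =
        (\<Sum>c\<in>Zvec M r. (\<Sum>v\<in>Zvec M r. A v * ?ch c v) * zeta M powi (- (\<Sum>i=1..r. c i * w i)))" by simp
    also have "\<dots> = (\<Sum>c\<in>Zvec M r. K * zeta M powi (\<Sum>i=1..r. c i * (d i - w i)))"
      by (intro sum.cong refl) (simp only: L[rule_format] mult.assoc diff)
    also have "\<dots> = (if d = w then K else 0) * of_nat M ^ r"
      unfolding sum_distrib_left [symmetric] by (subst Zvec_orthogonality[OF M d w]) simp
    finally show "A w = (if w = d then K else 0)" using M by (auto split: if_splits)
  qed
qed

text \<open>
  Reading off base M digits shows surjectivity; bijectivity follows by counting.
\<close>

lemma digit_sum_bij_betw: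
  assumes M: "M > 0"
  shows "bij_betw (\<lambda>v. nat (\<Sum>i=1..r. int M ^ (i - 1) * v i)) (Zvec M r) {..<M ^ r}"
proof -
  let ?e = "\<lambda>v. nat (\<Sum>i=1..r. int M ^ (i - 1) * v i)"
  have digits: "(\<Sum>i=1..r. M ^ (i - 1) * (a div M ^ (i - 1) mod M)) = a mod M ^ r" for a
  proof (induction r)
    case (Suc r)
    thus ?case by (simp add: mod_mult2_eq power_Suc2 del: power_Suc)
  qed auto
  have sub: "{..<M ^ r} \<subseteq> ?e ` Zvec M r"
  proof
    fix a assume a: "a \<in> {..<M ^ r}"
    let ?v = "restrict (\<lambda>i. int (a div M ^ (i - 1) mod M)) {1..r}"
    have "(\<Sum>i=1..r. int M ^ (i - 1) * ?v i) = int (\<Sum>i=1..r. M ^ (i - 1) * (a div M ^ (i - 1) mod M))"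
      by simp
    also have "\<dots> = int a" using a by (simp only: digits) simp
    finally have "?e ?v = a" by simp
    moreover have "?v \<in> Zvec M r"
      unfolding Zvec_def Zmod_eq using M by (intro restrict_PiE_iff[THEN iffD2]) (auto simp flip: of_nat_mod)
    ultimately show "a \<in> ?e ` Zvec M r" by force
  qed
  have le: "card (?e ` Zvec M r) \<le> M ^ r"
    using card_image_le[of "Zvec M r" ?e] by (simp add: card_Zvec)
  have "card {..<M ^ r} \<le> card (?e ` Zvec M r)" using sub by (intro card_mono) auto
  with le have card: "card (?e ` Zvec M r) = M ^ r" by simp
  have "?e ` Zvec M r = {..<M ^ r}" using sub card by (intro card_subset_eq[symmetric]) auto
  moreover have "inj_on ?e (Zvec M r)" using card by (intro eq_card_imp_inj_on) (auto simp: card_Zvec)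
  ultimately show ?thesis by (simp add: bij_betw_def)
qed

section \<open>Walsh transforms through the fibres of the lower digits\<close>

definition lower_digits :: "nat \<Rightarrow> (nat \<Rightarrow> (nat \<Rightarrow> int) \<Rightarrow> int) \<Rightarrow> (nat \<Rightarrow> int) \<Rightarrow> nat \<Rightarrow> int" where
  "lower_digits l b x = restrict (\<lambda>i. b i x) {1..l - 1}"

text \<open>
  The coefficient A_v: the character values collected in it are exactly those that occur alike in the
  transforms of the expansion f and of all component functions.
\<close>

definition fibre_sum ::
    "nat \<Rightarrow> nat \<Rightarrow> nat \<Rightarrow> nat \<Rightarrow> (nat \<Rightarrow> (nat \<Rightarrow> int) \<Rightarrow> int) \<Rightarrow> (nat \<Rightarrow> int) \<Rightarrow> (nat \<Rightarrow> int) \<Rightarrow> complex" where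
  "fibre_sum p n l t b u v =
     (\<Sum>x | x \<in> Zvec p n \<and> lower_digits l b x = v.
        zeta p powi (- dotp p n u x) * zeta (p ^ t) powi b l x)"

lemma lower_digits_in_Zvec:
  assumes "\<forall>i\<in>{1..l}. b i \<in> GB p n t" "x \<in> Zvec p n"
  shows "lower_digits l b x \<in> Zvec (p ^ t) (l - 1)"
proof -
  have "b i x \<in> Zmod (p ^ t)" if "i \<in> {1..l - 1}" for i
  proof -
    have "i \<in> {1..l}" using that by auto
    thus ?thesis using assms by (auto simp: GB_def)
  qed
  thus ?thesis by (auto simp: lower_digits_def Zvec_def)
qed

lemma sum_over_fibres:
  assumes "\<forall>i\<in>{1..l}. b i \<in> GB p n t"
  shows "(\<Sum>x\<in>Zvec p n. zeta p powi (- dotp p n u x) * zeta (p ^ t) powi b l x * h (lower_digits l b x))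
       = (\<Sum>v\<in>Zvec (p ^ t) (l - 1). fibre_sum p n l t b u v * h v)"
proof -
  let ?g = "\<lambda>x. zeta p powi (- dotp p n u x) * zeta (p ^ t) powi b l x"
  have "(\<Sum>x\<in>Zvec p n. ?g x * h (lower_digits l b x)) = (\<Sum>v\<in>Zvec (p ^ t) (l - 1).
      \<Sum>x | x \<in> Zvec p n \<and> lower_digits l b x = v. ?g x * h (lower_digits l b x))"
    using lower_digits_in_Zvec[OF assms] by (intro sum.group [symmetric]) auto
  also have "\<dots> = (\<Sum>v\<in>Zvec (p ^ t) (l - 1). fibre_sum p n l t b u v * h v)"
    unfolding fibre_sum_def sum_distrib_right by (intro sum.cong refl) auto
  finally show ?thesis .
qed

lemma WHT_component_comb:
  assumes p: "p > 0" and b: "\<forall>i\<in>{1..l}. b i \<in> GB p n t"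
  shows "WHT p n t (component_comb p n l t b c) u = of_real (real p powr (- (real n / 2))) *
    (\<Sum>v\<in>Zvec (p ^ t) (l - 1). fibre_sum p n l t b u v * zeta (p ^ t) powi (\<Sum>i=1..l - 1. c i * v i))"
proof -
  have "zeta (p ^ t) powi component_comb p n l t b c x =
      zeta (p ^ t) powi b l x * zeta (p ^ t) powi (\<Sum>i=1..l - 1. c i * lower_digits l b x i)"
    if "x \<in> Zvec p n" for x
  proof -
    have "(\<Sum>i=1..l - 1. c i * lower_digits l b x i) = (\<Sum>i=1..l - 1. c i * b i x)"
      by (intro sum.cong refl) (simp add: lower_digits_def)
    thus ?thesis
      using that p by (simp add: component_comb_def zeta_powi_mod power_int_add del: of_nat_power)
  qed
  thus ?thesis
    unfolding WHT_def sum_over_fibres[of l b p n t, OF b, symmetric] by (simp add: mult.assoc)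
qed

text \<open>
  The leading digit has weight M^(l-1) and so contributes a power of zeta_M, which is part of the
  fibre sum; only the lower digits leave powers of zeta_q.
\<close>

lemma WHT_base_expansion:
  assumes p: "p > 0" and l: "l \<ge> 1" and b: "\<forall>i\<in>{1..l}. b i \<in> GB p n t"
  shows "WHT p n (l * t) (base_expansion p n l t b) u = of_real (real p powr (- (real n / 2))) *
    (\<Sum>v\<in>Zvec (p ^ t) (l - 1). fibre_sum p n l t b u v *
       zeta (p ^ (l * t)) ^ nat (\<Sum>i=1..l - 1. int (p ^ t) ^ (i - 1) * v i))"
proof -
  let ?q = "p ^ (l * t)" and ?L = "(p ^ t) ^ (l - 1)"
  let ?e = "\<lambda>v. \<Sum>i=1..l - 1. int (p ^ t) ^ (i - 1) * v i"
  have q: "?q = ?L * p ^ t"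
    using power_minus_mult[of l "p ^ t"] l by (simp add: power_mult mult.commute[of l t])
  have "zeta ?q powi base_expansion p n l t b x =
      zeta (p ^ t) powi b l x * zeta ?q ^ nat (?e (lower_digits l b x))"
    if x: "x \<in> Zvec p n" for x
  proof -
    have pw: "int p ^ ((i - 1) * t) = int (p ^ t) ^ (i - 1)" for i
      by (simp add: power_mult mult.commute)
    have "{1..l} = insert l {1..l - 1}" using l by auto
    hence "base_expansion p n l t b x = int (p ^ t) ^ (l - 1) * b l x + (\<Sum>i=1..l - 1. int (p ^ t) ^ (i - 1) * b i x)"
      using x l unfolding base_expansion_def pw by (simp del: of_nat_power)
    also have "(\<Sum>i=1..l - 1. int (p ^ t) ^ (i - 1) * b i x) = ?e (lower_digits l b x)"
      by (intro sum.cong refl) (simp add: lower_digits_def)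
    also have "int (p ^ t) ^ (l - 1) = int ?L" by simp
    finally have "zeta ?q powi base_expansion p n l t b x =
        zeta ?q powi (int ?L * b l x) * zeta ?q powi ?e (lower_digits l b x)"
      by (simp only: power_int_add zeta_nonzero simp_thms)
    also have "zeta ?q powi (int ?L * b l x) = zeta (p ^ t) powi b l x"
      unfolding q using p by (intro zeta_mult_powi) simp
    also have "?e (lower_digits l b x) \<ge> 0"
      using lower_digits_in_Zvec[of l b p n t x, OF b x]
      by (intro sum_nonneg mult_nonneg_nonneg) (auto simp: Zvec_def Zmod_eq)
    hence "zeta ?q powi ?e (lower_digits l b x) = zeta ?q ^ nat (?e (lower_digits l b x))"
      by (simp add: power_int_def)
    finally show ?thesis .
  qed
  thus ?thesis
    unfolding WHT_def sum_over_fibres[of l b p n t, OF b, symmetric] by (simp add: mult.assoc)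
qed

lemma fibre_sum_in_adjoin:
  assumes "p > 0" "t > 0"
  shows "fibre_sum p n l t b u v \<in> adjoin (zeta (p ^ t))"
proof -
  have "p ^ t = p ^ (t - 1) * p" using assms power_minus_mult[of t p] by simp
  hence "adjoin (zeta p) \<subseteq> adjoin (zeta (p ^ t))"
    using adjoin_zeta_mono[of "p ^ (t - 1)" p] assms by simp
  thus ?thesis
    unfolding fibre_sum_def using assms zeta_powi_adjoin[of p] zeta_powi_adjoin[of "p ^ t"]
    by (intro adjoin_sum adjoin_mult) auto
qed

text \<open>
  Up to normalisation the transform is \<alpha> = (sum of A_v * zeta_q^e(v)). If |\<alpha>|^2 = p^n, then
  \<alpha> = s * zeta_q^m * G^n, and m = L*j + e(d) modulo q turns this into the single term
  s * zeta_M^j * G^n * zeta_q^e(d) with a coefficient in \<int>[zeta_M]. Linear independence identifies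
  the coefficients on both sides.
\<close>

lemma norm_WHT_base_expansion_iff:
  assumes p: "prime p" "odd p" and l: "l \<ge> 1" and t: "t \<ge> 1"
    and b: "\<forall>i\<in>{1..l}. b i \<in> GB p n t"
    and G: "G \<in> adjoin (zeta p)" "G\<^sup>2 = \<sigma> * of_nat p" and \<sigma>: "\<sigma> \<in> {1, -1}"
  shows "cmod (WHT p n (l * t) (base_expansion p n l t b) u) = 1 \<longleftrightarrow>
    (\<exists>d\<in>Zvec (p ^ t) (l - 1). \<exists>j\<in>Zmod (p ^ t). \<exists>s\<in>{1, -1}. \<forall>v\<in>Zvec (p ^ t) (l - 1).
       fibre_sum p n l t b u v = (if v = d then s * zeta (p ^ t) powi j * G ^ n else 0))"
    (is "?L \<longleftrightarrow> ?R")
proof -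
  interpret odd_prime_power p "l * t" using p l t by unfold_locales auto
  define M where "M = p ^ t"
  define L where "L = M ^ (l - 1)"
  define V where "V = Zvec M (l - 1)"
  define A where "A = fibre_sum p n l t b u"
  define e where "e = (\<lambda>v. nat (\<Sum>i=1..l - 1. int M ^ (i - 1) * v i))"
  define \<alpha> where "\<alpha> = (\<Sum>v\<in>V. A v * z ^ e v)"
  have M: "M > 0" by (simp add: M_def)
  have L: "L > 0" using M by (simp add: L_def)
  have q: "q = L * M"
    using power_minus_mult[of l "p ^ t"] l by (simp add: L_def M_def power_mult mult.commute[of l t])
  have pM: "p dvd M" using t by (simp add: M_def)
  have bij: "bij_betw e V {..<L}"
    unfolding e_def V_def L_def using M by (rule digit_sum_bij_betw)
  have finV: "finite V" by (simp add: V_def)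
  have zL: "z ^ L = zeta M" using zeta_mult_power[OF L, of M] q by simp
  have MQ: "adjoin (zeta M) \<subseteq> adjoin z" using adjoin_zeta_mono[OF L, of M] q by simp
  have "M = p ^ (t - 1) * p" using t power_minus_mult[of t p] by (simp add: M_def)
  hence pMs: "adjoin (zeta p) \<subseteq> adjoin (zeta M)" using adjoin_zeta_mono[of "p ^ (t - 1)" p] by simp
  have GM: "G \<in> adjoin (zeta M)" using G(1) pMs by blast
  have Gz: "G \<in> adjoin z" using GM MQ by blast
  have AM: "A v \<in> adjoin (zeta M)" for v
    unfolding A_def M_def using t by (intro fibre_sum_in_adjoin) auto
  have normG: "(cmod G)\<^sup>2 = real p" using arg_cong[OF G(2), of cmod] \<sigma> by (auto simp: norm_mult norm_power)
  have "WHT p n (l * t) (base_expansion p n l t b) u = of_real (real p powr (- (real n / 2))) * \<alpha>"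
    unfolding \<alpha>_def A_def e_def V_def M_def by (rule WHT_base_expansion[OF p_gt_0 l b])
  hence "cmod (WHT p n (l * t) (base_expansion p n l t b) u) = real p powr (- (real n / 2)) * cmod \<alpha>"
    by (simp add: norm_mult)
  also have "\<dots> = 1 \<longleftrightarrow> cmod \<alpha> = real p powr (real n / 2)"
    using p_gt_1 by (auto simp: powr_minus field_simps)
  also have "\<dots> \<longleftrightarrow> (cmod \<alpha>)\<^sup>2 = (real p powr (real n / 2))\<^sup>2"
    by (simp add: power2_eq_iff_nonneg)
  also have "(real p powr (real n / 2))\<^sup>2 = real p ^ n"
    by (simp add: power2_eq_square powr_realpow flip: powr_add)
  finally have norm_iff: "?L \<longleftrightarrow> (cmod \<alpha>)\<^sup>2 = real p ^ n" .
  show ?thesis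
  proof
    assume ?L
    hence "(cmod \<alpha>)\<^sup>2 = real p ^ n" using norm_iff by simp
    moreover have "\<alpha> \<in> adjoin z"
      unfolding \<alpha>_def using AM MQ by (intro adjoin_sum adjoin_mult adjoin_power adjoin_gen) auto
    ultimately obtain m s where s: "s \<in> {1, -1}" and \<alpha>: "\<alpha> = s * z ^ m * G ^ n"
      using norm_p_power_in_adjoin_zeta[OF _ _ Gz G(2) \<sigma>] by blast
    define j where "j = m mod q div L"
    define e0 where "e0 = m mod q mod L"
    have e0: "e0 < L" using L by (simp add: e0_def)
    have jM: "j < M"
      using q_gt_0 by (simp add: j_def q less_mult_imp_div_less mult.commute[of L])
    have "z ^ m = z ^ (L * j + e0)" by (simp add: j_def e0_def z_power_mod)
    also have "\<dots> = zeta M ^ j * z ^ e0"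
      unfolding zL [symmetric] power_mult [symmetric] by (rule power_add)
    finally have zm: "z ^ m = zeta M ^ j * z ^ e0" .
    obtain d where d: "d \<in> V" "e d = e0"
      using e0 bij by (metis bij_betw_def imageE lessThan_iff)
    let ?K = "s * zeta M ^ j * G ^ n"
    let ?B = "\<lambda>v. A v - (if v = d then ?K else 0)"
    let ?e' = "the_inv_into V e"
    have e': "?e' (e v) = v" if "v \<in> V" for v
      using that bij by (simp add: the_inv_into_f_f bij_betw_def)
    have "(\<Sum>i<L. ?B (?e' i) * z ^ i) = (\<Sum>v\<in>V. ?B (?e' (e v)) * z ^ e v)"
      by (rule sum.reindex_bij_betw[OF bij, symmetric])
    also have "\<dots> = (\<Sum>v\<in>V. A v * z ^ e v - (if v = d then ?K * z ^ e v else 0))"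
      by (intro sum.cong refl) (auto simp: e' algebra_simps)
    also have "\<dots> = \<alpha> - ?K * z ^ e d"
      using d finV by (simp add: sum_subtractf \<alpha>_def)
    also have "\<dots> = 0" by (simp add: \<alpha> zm d)
    finally have sum0: "(\<Sum>i<L. ?B (?e' i) * z ^ i) = 0" .
    have K: "?K \<in> adjoin (zeta M)" using s GM by auto
    have "?B (?e' (e v)) = 0" if v: "v \<in> V" for v
    proof (rule zeta_powers_independent[OF q pM _ sum0])
      show "e v < L" using bij v by (auto simp: bij_betw_def)
      show "?B (?e' i) \<in> adjoin (zeta M)" for i
        using K AM by (cases "?e' i = d") simp_all
    qed
    hence "\<forall>v\<in>V. A v = (if v = d then s * zeta M powi int j * G ^ n else 0)"
      using e' by auto
    moreover have "int j \<in> Zmod M" using jM by (simp add: Zmod_eq)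
    ultimately show ?R using d(1) s unfolding V_def A_def M_def by blast
  next
    assume ?R
    then obtain d j s where d: "d \<in> V" and s: "s \<in> {1, -1}"
      and A: "\<And>v. v \<in> V \<Longrightarrow> A v = (if v = d then s * zeta M powi j * G ^ n else 0)"
      unfolding V_def A_def M_def by blast
    have "\<alpha> = (\<Sum>v\<in>V. if v = d then s * zeta M powi j * G ^ n * z ^ e v else 0)"
      unfolding \<alpha>_def using A by (intro sum.cong) auto
    also have "\<dots> = s * zeta M powi j * G ^ n * z ^ e d" using d finV by simp
    finally have "cmod \<alpha> = cmod G ^ n" using s by (auto simp: norm_mult norm_power norm_power_int)
    hence "(cmod \<alpha>)\<^sup>2 = ((cmod G)\<^sup>2) ^ n" by (simp add: mult.commute flip: power_mult)
    thus ?L using norm_iff normG by simp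
  qed
qed

theorem theorem3p3:
  fixes p n l t k :: nat
    and f :: "(nat \<Rightarrow> int) \<Rightarrow> int"
    and b :: "nat \<Rightarrow> (nat \<Rightarrow> int) \<Rightarrow> int"
  assumes "prime p" and "odd p"
    and "n \<ge> 1" and "l \<ge> 1" and "t \<ge> 1"
    and "k = l * t"
    and "\<And>i. 1 \<le> i \<Longrightarrow> i \<le> l \<Longrightarrow> b i \<in> GB p n t"
    and "f \<in> GB p n k"
    and "f = base_expansion p n l t b"
  shows "gbent p n k f \<longleftrightarrow>
    (\<forall>u\<in>Zvec p n.
      \<exists>d\<in>Zvec (p ^ t) (l - 1). \<exists>j\<in>Zmod (p ^ t). \<exists>s\<in>{1, -1 :: complex}.
        \<forall>c\<in>Zvec (p ^ t) (l - 1).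
          (even n \<or> (odd n \<and> [p = 1] (mod 4)) \<longrightarrow>
             WHT p n t (component_comb p n l t b c) u
               = s * zeta (p ^ t) powi (j + dotp (p ^ t) (l - 1) c d)) \<and>
          (odd n \<and> [p = 3] (mod 4) \<longrightarrow>
             WHT p n t (component_comb p n l t b c) u
               = s * \<i> * zeta (p ^ t) powi (j + dotp (p ^ t) (l - 1) c d)))"
proof -
  have b: "\<forall>i\<in>{1..l}. b i \<in> GB p n t" using assms(7) by auto
  have p0: "p > 0" using assms(1) prime_gt_0_nat by blast
  obtain G where G: "G \<in> adjoin (zeta p)" "G\<^sup>2 = (-1) ^ ((p - 1) div 2) * of_nat p"
    using obtain_sqrt_signed_prime[OF assms(1,2)] .
  let ?\<sigma> = "(-1) ^ ((p - 1) div 2) :: complex"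
  have \<sigma>: "?\<sigma> \<in> {1, -1}" by (cases "even ((p - 1) div 2)") auto
  define \<rho> where "\<rho> = complex_of_real (real p powr (- (real n / 2)))"
  \<comment> \<open>The normalised G^n is a fourth root of unity; its square decides between the two cases.\<close>
  define \<eta> where "\<eta> = \<rho> * G ^ n"
  have "(real p powr (- (real n / 2)))\<^sup>2 = real p powr (- real n)"
    by (simp add: power2_eq_square flip: powr_add)
  also have "\<dots> = inverse (real p ^ n)" using p0 by (simp add: powr_minus powr_realpow)
  finally have "(real p powr (- (real n / 2)))\<^sup>2 = inverse (real p ^ n)" .
  moreover have "\<rho>\<^sup>2 = of_real ((real p powr (- (real n / 2)))\<^sup>2)" by (simp add: \<rho>_def)
  ultimately have \<rho>2: "\<rho>\<^sup>2 = inverse (of_nat p ^ n)" by simp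
  have \<rho>0: "\<rho> \<noteq> 0" using p0 by (simp add: \<rho>_def)
  have "\<eta>\<^sup>2 = \<rho>\<^sup>2 * (G\<^sup>2) ^ n"
    by (simp add: \<eta>_def power_mult_distrib mult.commute flip: power_mult)
  also have "\<dots> = ?\<sigma> ^ n" using p0 by (simp add: \<rho>2 G(2) power_mult_distrib)
  finally have \<eta>2: "\<eta>\<^sup>2 = ?\<sigma> ^ n" .
  have parity: "([p = 1] (mod 4) \<longrightarrow> even ((p - 1) div 2)) \<and> ([p = 3] (mod 4) \<longrightarrow> odd ((p - 1) div 2))"
  proof -
    have p4: "p = 4 * (p div 4) + p mod 4" by simp
    have "(p - 1) div 2 = 2 * (p div 4)" if "p mod 4 = 1" using p4 that by linarith
    moreover have "(p - 1) div 2 = 2 * (p div 4) + 1" if "p mod 4 = 3" using p4 that by linarith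
    ultimately show ?thesis by (simp add: cong_def)
  qed
  have p_mod: "[p = 1] (mod 4) \<or> [p = 3] (mod 4)"
  proof -
    have "p mod 4 = 1 \<or> p mod 4 = 3" using assms(2) by presburger
    thus ?thesis by (simp add: cong_def)
  qed
  have case1: "\<eta> \<in> {1, -1}" if "even n \<or> (odd n \<and> [p = 1] (mod 4))"
  proof -
    have "even n \<or> even ((p - 1) div 2)" using that parity by blast
    hence "?\<sigma> ^ n = 1" by (auto simp flip: power_mult)
    hence "\<eta>\<^sup>2 = 1" using \<eta>2 by simp
    thus ?thesis by (simp add: power2_eq_1_iff)
  qed
  have case2: "\<eta> \<in> {\<i>, -\<i>}" if "odd n \<and> [p = 3] (mod 4)"
  proof -
    have "odd n" "odd ((p - 1) div 2)" using that parity by blast+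
    hence "\<eta>\<^sup>2 = \<i>\<^sup>2" using \<eta>2 by simp
    thus ?thesis by (simp only: power2_eq_iff) auto
  qed
  let ?V = "Zvec (p ^ t) (l - 1)" and ?M = "p ^ t"
  have M0: "?M > 0" using p0 by simp
  let ?cond = "\<lambda>u d j s. \<forall>c\<in>?V.
          (even n \<or> (odd n \<and> [p = 1] (mod 4)) \<longrightarrow>
             WHT p n t (component_comb p n l t b c) u
               = s * zeta (p ^ t) powi (j + dotp (p ^ t) (l - 1) c d)) \<and>
          (odd n \<and> [p = 3] (mod 4) \<longrightarrow>
             WHT p n t (component_comb p n l t b c) u
               = s * \<i> * zeta (p ^ t) powi (j + dotp (p ^ t) (l - 1) c d))"
  let ?\<kappa> = "\<lambda>s. if odd n \<and> [p = 3] (mod 4) then s * \<i> else s"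
  have excl: "\<not> ([p = 1] (mod 4) \<and> [p = 3] (mod 4))" by (auto simp: cong_def)
  \<comment> \<open>As \<eta> is one of the two allowed values itself, s * \<eta> runs through both of them.\<close>
  have sign: "(\<exists>s\<in>{1, -1}. Q (s * \<eta>)) \<longleftrightarrow> (\<exists>s\<in>{1, -1}. Q (?\<kappa> s))" for Q :: "complex \<Rightarrow> bool"
    using case1 case2 p_mod excl by (cases "odd n \<and> [p = 3] (mod 4)") auto
  have cond_iff: "?cond u d j s \<longleftrightarrow>
      (\<forall>v\<in>?V. \<rho> * fibre_sum p n l t b u v = (if v = d then ?\<kappa> s * zeta ?M powi j else 0))"
    if d: "d \<in> ?V" for u d j s
  proof -
    have "?cond u d j s \<longleftrightarrow> (\<forall>c\<in>?V. WHT p n t (component_comb p n l t b c) u =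
        ?\<kappa> s * zeta ?M powi (j + dotp ?M (l - 1) c d))"
      using p_mod excl by auto
    also have "\<dots> \<longleftrightarrow> (\<forall>c\<in>?V. (\<Sum>v\<in>?V. \<rho> * fibre_sum p n l t b u v * zeta ?M powi (\<Sum>i=1..l - 1. c i * v i)) =
        ?\<kappa> s * zeta ?M powi j * zeta ?M powi (\<Sum>i=1..l - 1. c i * d i))"
      unfolding WHT_component_comb[OF p0 b] \<rho>_def [symmetric] dotp_def
      by (simp only: power_int_add zeta_nonzero simp_thms zeta_powi_mod[OF M0] sum_distrib_left mult.assoc)
    also have "\<dots> \<longleftrightarrow> (\<forall>v\<in>?V. \<rho> * fibre_sum p n l t b u v = (if v = d then ?\<kappa> s * zeta ?M powi j else 0))"
      by (rule Zvec_fourier_delta_iff[OF M0 d])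
    finally show ?thesis .
  qed
  have key: "cmod (WHT p n k f u) = 1 \<longleftrightarrow> (\<exists>d\<in>?V. \<exists>j\<in>Zmod ?M. \<exists>s\<in>{1, -1}. ?cond u d j s)" for u
  proof -
    have "cmod (WHT p n k f u) = 1 \<longleftrightarrow> (\<exists>d\<in>?V. \<exists>j\<in>Zmod ?M. \<exists>s\<in>{1, -1}. \<forall>v\<in>?V.
        fibre_sum p n l t b u v = (if v = d then s * zeta ?M powi j * G ^ n else 0))"
      unfolding assms(6,9)
      by (rule norm_WHT_base_expansion_iff[OF assms(1,2,4,5) b G \<sigma>])
    also have "\<dots> \<longleftrightarrow> (\<exists>d\<in>?V. \<exists>j\<in>Zmod ?M. \<exists>s\<in>{1, -1}. \<forall>v\<in>?V.
        \<rho> * fibre_sum p n l t b u v = (if v = d then (s * \<eta>) * zeta ?M powi j else 0))"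
    proof -
      have "x = (if P then s * y * G ^ n else 0) \<longleftrightarrow> \<rho> * x = (if P then (s * \<eta>) * y else 0)" for x y s :: complex and P
        using \<rho>0 by (auto simp: \<eta>_def mult_ac)
      thus ?thesis by simp
    qed
    also have "\<dots> \<longleftrightarrow> (\<exists>d\<in>?V. \<exists>j\<in>Zmod ?M. \<exists>s\<in>{1, -1}. \<forall>v\<in>?V.
        \<rho> * fibre_sum p n l t b u v = (if v = d then ?\<kappa> s * zeta ?M powi j else 0))"
      by (intro bex_cong refl sign)
    also have "\<dots> \<longleftrightarrow> (\<exists>d\<in>?V. \<exists>j\<in>Zmod ?M. \<exists>s\<in>{1, -1}. ?cond u d j s)"
      by (intro bex_cong refl cond_iff [symmetric])
    finally show ?thesis .
  qed
  have "gbent p n k f \<longleftrightarrow> (\<forall>u\<in>Zvec p n. cmod (WHT p n k f u) = 1)"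
    using assms(8) by (simp add: gbent_def)
  thus ?thesis unfolding key .
qed

end
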